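(* Let $\Sigma^{\ast}$ be a finite complete nonsingular fan in $N$. Then the following are equivalent. (1) There exist a complete nonsingular toric variety $X$ and an equivariant blow-up $\varphi:T_N\mathrm{emb}(\Sigma^{\ast})\to X$ along a $T_N$-invariant closed irreducible subvariety of $X$ of codimension at least two. (2) There exists $P^{\ast}=\{x_1,\dots,x_l\}\in\mathrm{PC}(\Sigma^{\ast})$ whose primitive relation is $x_1+\cdots+x_l=x$ for some $x\in\mathrm{G}(\Sigma^{\ast})$, and such that for any $\sigma^{\ast}\in\Sigma^{\ast}$ which contains $x$ and for every $1\le i\le l$, the set $(\mathrm{G}(\sigma^{\ast})\cup P^{\ast})\setminus\{x_i\}$ generates a strongly convex rational polyhedral cone belonging to $\Sigma^{\ast}$. (3) There exists $P^{\ast}=\{x_1,\dots,x_l\}\in\mathrm{PC}(\Sigma^{\ast})$ whose primitive relation is $x_1+\cdots+x_l=x$ for some $x\in\mathrm{G}(\Sigma^{\ast})$, and such that for any $P'\in\mathrm{PC}(\Sigma^{\ast})$ with $P^{\ast}\cap P'\neq\emptyset$ and $P^{\ast}\neq P'$, the set $(P'\setminus P^{\ast})\cup\{x\}$ contains a primitive collection of $\Sigma^{\ast}$.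
   Context: $N$ is a free abelian group of rank $d$, $N_{\mathbf R}=N\otimes_{\mathbf Z}\mathbf R$, $T_N$ the corresponding algebraic torus, and $T_N\mathrm{emb}(\Sigma)$ the toric variety of a fan $\Sigma$ in $N$. A fan is nonsingular if each cone is generated by part of a $\mathbf Z$-basis of $N$. $\mathrm{G}(\Sigma)$ is the set of primitive generators of the one-dimensional cones of $\Sigma$, and $\mathrm{G}(\sigma)=\sigma\cap\mathrm{G}(\Sigma)$ for $\sigma\in\Sigma$. $\mathrm{Cone}(S)=\sum_{s\in S}\mathbf R_{\ge0}s$; $\mathrm{Relint}$ denotes relative interior. A nonempty subset $P\subset\mathrm{G}(\Sigma)$ is a primitive collection of a finite complete simplicial fan $\Sigma$ if $\mathrm{Cone}(P)\notin\Sigma$ while $\mathrm{Cone}(P\setminus\{y\})\in\Sigma$ for every $y\in P$; $\mathrm{PC}(\Sigma)$ is the set of these. For $\Sigma$ finite complete nonsingular and $P=\{x_1,\dots,x_l\}\in\mathrm{PC}(\Sigma)$, let $\sigma(P)\in\Sigma$ be the unique cone with $x_1+\cdots+x_l\in\mathrm{Relint}(\sigma(P))$, and let $\mathrm{G}(\sigma(P))=\{y_1,\dots,y_m\}$; the resulting relation $x_1+\cdots+x_l=a_1y_1+\cdots+a_my_m$ with $a_j\in\mathbf Z_{>0}$ is the primitive relation of $P$. The equivariant blow-up of $T_N\mathrm{emb}(\Sigma)$ ($\Sigma$ complete nonsingular) along the $T_N$-invariant closed irreducible subvariety $\overline{\mathrm{orb}(\sigma)}$, where $\sigma\in\Sigma$,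 $\dim\sigma=l\ge2$, $\mathrm{G}(\sigma)=\{x_1,\dots,x_l\}$, is the morphism corresponding to the star subdivision of $\Sigma$ along $\sigma$ with new ray generated by $x_1+\cdots+x_l$ (each cone $\sigma+\tau'\in\Sigma$ with $\tau'\in\Sigma$, $\sigma\cap\tau'=\{0\}$ is replaced by the cones $\mathrm{Cone}((\mathrm{G}(\sigma)\setminus\{x_i\})\cup\{x_1+\cdots+x_l\})+\tau'$, $1\le i\le l$, and their faces). *)

theory Defs
  imports "HOL-Analysis.Analysis" "HOL-Computational_Algebra.Polynomial"
begin

text \<open>
  A free abelian group \<open>N\<close> of rank \<open>d\<close> is realised as the group of integral combinations of
  \<open>d\<close> linearly independent vectors of some Euclidean space, so that \<open>N \<otimes> \<real>\<close> is \<open>span N\<close>.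
  The ambient space may be larger than \<open>span N\<close>; in particular \<open>d = 0\<close> is allowed.
\<close>

definition lattice_basis :: "'a::euclidean_space set \<Rightarrow> 'a set \<Rightarrow> bool" where
  "lattice_basis N B \<longleftrightarrow>
     finite B \<and> independent B \<and> N = {\<Sum>b\<in>B. real_of_int (c b) *\<^sub>R b | c. True}"

definition free_abelian_of_rank :: "'a::euclidean_space set \<Rightarrow> nat \<Rightarrow> bool" where
  "free_abelian_of_rank N d \<longleftrightarrow> (\<exists>B. lattice_basis N B \<and> card B = d)"

abbreviation Cone :: "'a::euclidean_space set \<Rightarrow> 'a set" where
  "Cone S \<equiv> convex_cone hull S"

definition scrp_cone :: "'a::euclidean_space set \<Rightarrow> 'a set \<Rightarrow> bool" where
  "scrp_cone N \<sigma> \<longleftrightarrow>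
     (\<exists>S. finite S \<and> S \<subseteq> N \<and> \<sigma> = Cone S) \<and> \<sigma> \<inter> uminus ` \<sigma> = {0}"

text \<open>
  The library's \<open>face_of\<close> also admits the empty set as a face; the nonempty faces of a
  polyhedral cone \<open>\<sigma>\<close> are its faces \<open>\<sigma> \<inter> m\<^sup>\<bottom>\<close>, for \<open>m\<close> nonnegative on \<open>\<sigma>\<close>.
\<close>

definition cone_face :: "'a::euclidean_space set \<Rightarrow> 'a set \<Rightarrow> bool" where
  "cone_face \<tau> \<sigma> \<longleftrightarrow> \<tau> face_of \<sigma> \<and> \<tau> \<noteq> {}"

definition fan :: "'a::euclidean_space set \<Rightarrow> 'a set set \<Rightarrow> bool" where
  "fan N \<Sigma> \<longleftrightarrow>
     \<Sigma> \<noteq> {} \<and>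
     (\<forall>\<sigma>\<in>\<Sigma>. scrp_cone N \<sigma>) \<and>
     (\<forall>\<sigma>\<in>\<Sigma>. \<forall>\<tau>. cone_face \<tau> \<sigma> \<longrightarrow> \<tau> \<in> \<Sigma>) \<and>
     (\<forall>\<sigma>\<in>\<Sigma>. \<forall>\<tau>\<in>\<Sigma>. cone_face (\<sigma> \<inter> \<tau>) \<sigma> \<and> cone_face (\<sigma> \<inter> \<tau>) \<tau>)"

definition complete_fan :: "'a::euclidean_space set \<Rightarrow> 'a set set \<Rightarrow> bool" where
  "complete_fan N \<Sigma> \<longleftrightarrow> \<Union>\<Sigma> = span N"

definition nonsingular_fan :: "'a::euclidean_space set \<Rightarrow> 'a set set \<Rightarrow> bool" where
  "nonsingular_fan N \<Sigma> \<longleftrightarrow> (\<forall>\<sigma>\<in>\<Sigma>. \<exists>B S. lattice_basis N B \<and> S \<subseteq> B \<and> \<sigma> = Cone S)"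

definition finite_complete_nonsingular_fan :: "'a::euclidean_space set \<Rightarrow> 'a set set \<Rightarrow> bool" where
  "finite_complete_nonsingular_fan N \<Sigma> \<longleftrightarrow>
     fan N \<Sigma> \<and> finite \<Sigma> \<and> complete_fan N \<Sigma> \<and> nonsingular_fan N \<Sigma>"

definition primitive_vector :: "'a::euclidean_space set \<Rightarrow> 'a \<Rightarrow> bool" where
  "primitive_vector N v \<longleftrightarrow>
     v \<in> N \<and> v \<noteq> 0 \<and> (\<forall>w\<in>N. \<forall>k::nat. v = real k *\<^sub>R w \<longrightarrow> k = 1)"

definition fan_gens :: "'a::euclidean_space set \<Rightarrow> 'a set set \<Rightarrow> 'a set" where
  "fan_gens N \<Sigma> = {v. primitive_vector N v \<and> (\<exists>\<rho>\<in>\<Sigma>. dim \<rho> = 1 \<and> \<rho> = Cone {v})}"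

definition cone_gens :: "'a::euclidean_space set \<Rightarrow> 'a set set \<Rightarrow> 'a set \<Rightarrow> 'a set" where
  "cone_gens N \<Sigma> \<sigma> = \<sigma> \<inter> fan_gens N \<Sigma>"

definition primitive_collection :: "'a::euclidean_space set \<Rightarrow> 'a set set \<Rightarrow> 'a set \<Rightarrow> bool" where
  "primitive_collection N \<Sigma> P \<longleftrightarrow>
     P \<noteq> {} \<and> P \<subseteq> fan_gens N \<Sigma> \<and> Cone P \<notin> \<Sigma> \<and> (\<forall>y\<in>P. Cone (P - {y}) \<in> \<Sigma>)"

definition PC :: "'a::euclidean_space set \<Rightarrow> 'a set set \<Rightarrow> 'a set set" where
  "PC N \<Sigma> = {P. primitive_collection N \<Sigma> P}"

definition primitive_cone :: "'a::euclidean_space set set \<Rightarrow> 'a set \<Rightarrow> 'a set" where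
  "primitive_cone \<Sigma> P = (THE \<sigma>. \<sigma> \<in> \<Sigma> \<and> (\<Sum>x\<in>P. x) \<in> rel_interior \<sigma>)"

text \<open>
  \<open>primitive_relation N \<Sigma> P Y a\<close>: the primitive relation of \<open>P\<close> is \<open>\<Sum>P = (\<Sum>y\<in>Y. a y \<cdot> y)\<close>.
\<close>

definition primitive_relation ::
  "'a::euclidean_space set \<Rightarrow> 'a set set \<Rightarrow> 'a set \<Rightarrow> 'a set \<Rightarrow> ('a \<Rightarrow> int) \<Rightarrow> bool" where
  "primitive_relation N \<Sigma> P Y a \<longleftrightarrow>
     Y = cone_gens N \<Sigma> (primitive_cone \<Sigma> P) \<and>
     (\<forall>y\<in>Y. a y > 0) \<and>
     (\<Sum>x\<in>P. x) = (\<Sum>y\<in>Y. real_of_int (a y) *\<^sub>R y)"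

text \<open>
  The dual lattice is identified, via the inner product, with a lattice in \<open>span N\<close>.
\<close>

definition dual_lattice :: "'a::euclidean_space set \<Rightarrow> 'a set" where
  "dual_lattice N = {m \<in> span N. \<forall>n\<in>N. m \<bullet> n \<in> \<int>}"

definition dual_semigroup :: "'a::euclidean_space set \<Rightarrow> 'a set \<Rightarrow> 'a set" where
  "dual_semigroup N \<sigma> = {m \<in> dual_lattice N. \<forall>v\<in>\<sigma>. 0 \<le> m \<bullet> v}"

text \<open>
  The closed points of the affine toric variety of \<open>\<sigma>\<close> over an algebraically closed field
  are the unital semigroup homomorphisms from \<open>\<sigma>\<^sup>\<or> \<inter> M\<close> to the multiplicative monoid of the field.
  Its coordinate ring is spanned by the characters \<open>u \<mapsto> u m\<close>.
\<close>

definition affine_toric :: "'a::euclidean_space set \<Rightarrow> 'a set \<Rightarrow> ('a \<Rightarrow> 'k::alg_closed_field) set" where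
  "affine_toric N \<sigma> = {u \<in> extensional (dual_semigroup N \<sigma>).
     u 0 = 1 \<and>
     (\<forall>m\<in>dual_semigroup N \<sigma>. \<forall>m'\<in>dual_semigroup N \<sigma>. u (m + m') = u m * u m')}"

definition regular_functions ::
  "'a::euclidean_space set \<Rightarrow> 'a set \<Rightarrow> (('a \<Rightarrow> 'k::alg_closed_field) \<Rightarrow> 'k) set" where
  "regular_functions N \<sigma> =
     {\<lambda>u. \<Sum>m\<in>A. c m * u m | A c. finite A \<and> A \<subseteq> dual_semigroup N \<sigma>}"

text \<open>
  The affine pieces of \<open>\<sigma>\<close> and \<open>\<sigma>'\<close> are glued along that of \<open>\<sigma> \<inter> \<sigma>'\<close>; the inclusion of the
  latter is the restriction of homomorphisms.
\<close>

definition glue ::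
  "'a::euclidean_space set \<Rightarrow> 'a set set \<Rightarrow>
     (('a set \<times> ('a \<Rightarrow> 'k::alg_closed_field)) \<times> ('a set \<times> ('a \<Rightarrow> 'k))) set" where
  "glue N \<Sigma> = {((\<sigma>, u), (\<sigma>', u')). \<sigma> \<in> \<Sigma> \<and> \<sigma>' \<in> \<Sigma> \<and>
     (\<exists>w\<in>affine_toric N (\<sigma> \<inter> \<sigma>').
        u = restrict w (dual_semigroup N \<sigma>) \<and> u' = restrict w (dual_semigroup N \<sigma>'))}"

type_synonym ('a, 'k) toric_point = "('a set \<times> ('a \<Rightarrow> 'k)) set"

definition T_emb ::
  "'a::euclidean_space set \<Rightarrow> 'a set set \<Rightarrow> ('a, 'k::alg_closed_field) toric_point set" where
  "T_emb N \<Sigma> = (SIGMA \<sigma>:\<Sigma>. affine_toric N \<sigma>) // glue N \<Sigma>"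

definition chart ::
  "'a::euclidean_space set \<Rightarrow> 'a set set \<Rightarrow> 'a set \<Rightarrow> ('a \<Rightarrow> 'k::alg_closed_field) \<Rightarrow>
     ('a, 'k) toric_point" where
  "chart N \<Sigma> \<sigma> u = glue N \<Sigma> `` {(\<sigma>, u)}"

definition zariski_closed ::
  "'a::euclidean_space set \<Rightarrow> 'a set set \<Rightarrow> ('a, 'k::alg_closed_field) toric_point set \<Rightarrow> bool" where
  "zariski_closed N \<Sigma> V \<longleftrightarrow> V \<subseteq> T_emb N \<Sigma> \<and>
     (\<forall>\<sigma>\<in>\<Sigma>. \<exists>F \<subseteq> regular_functions N \<sigma>.
        {u \<in> affine_toric N \<sigma>. chart N \<Sigma> \<sigma> u \<in> V} =
        {u \<in> affine_toric N \<sigma>. \<forall>f\<in>F. f u = 0})"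

definition orb ::
  "'a::euclidean_space set \<Rightarrow> 'a set set \<Rightarrow> 'a set \<Rightarrow> ('a, 'k::alg_closed_field) toric_point set" where
  "orb N \<Sigma> \<sigma> = chart N \<Sigma> \<sigma> ` {u \<in> affine_toric N \<sigma>.
     \<forall>m\<in>dual_semigroup N \<sigma>. u m \<noteq> 0 \<longleftrightarrow> (\<forall>v\<in>\<sigma>. m \<bullet> v = 0)}"

definition orbit_closure ::
  "'a::euclidean_space set \<Rightarrow> 'a set set \<Rightarrow> 'a set \<Rightarrow> ('a, 'k::alg_closed_field) toric_point set" where
  "orbit_closure N \<Sigma> \<sigma> = \<Inter>{V. zariski_closed N \<Sigma> V \<and> orb N \<Sigma> \<sigma> \<subseteq> V}"

text \<open>
  The equivariant morphism given by the identity of \<open>N\<close>, for \<open>\<Sigma>'\<close> a refinement of \<open>\<Sigma>\<close>: on the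
  affine piece of \<open>\<sigma>' \<in> \<Sigma>'\<close> it is the restriction of homomorphisms to \<open>\<sigma>\<^sup>\<or> \<inter> M\<close>, for any
  \<open>\<sigma> \<in> \<Sigma>\<close> containing \<open>\<sigma>'\<close>.
\<close>

definition toric_morphism ::
  "'a::euclidean_space set \<Rightarrow> 'a set set \<Rightarrow> 'a set set \<Rightarrow>
     ('a, 'k::alg_closed_field) toric_point \<Rightarrow> ('a, 'k) toric_point" where
  "toric_morphism N \<Sigma>' \<Sigma> = (\<lambda>p\<in>T_emb N \<Sigma>'.
     THE q. \<exists>\<sigma>'\<in>\<Sigma>'. \<exists>\<sigma>\<in>\<Sigma>. \<exists>u\<in>affine_toric N \<sigma>'. \<sigma>' \<subseteq> \<sigma> \<and> p = chart N \<Sigma>' \<sigma>' u \<and>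
       q = chart N \<Sigma> \<sigma> (restrict u (dual_semigroup N \<sigma>)))"

definition complete_nonsingular_toric_variety ::
  "'a::euclidean_space set \<Rightarrow> ('a, 'k::alg_closed_field) toric_point set \<Rightarrow> bool" where
  "complete_nonsingular_toric_variety N X \<longleftrightarrow>
     (\<exists>\<Sigma>. finite_complete_nonsingular_fan N \<Sigma> \<and> X = T_emb N \<Sigma>)"

text \<open>
  The torus-invariant closed irreducible subvarieties are the closures of the orbits, and the
  closure of \<open>orb \<sigma>\<close> has codimension \<open>dim \<sigma>\<close>.
\<close>

definition invariant_subvariety ::
  "'a::euclidean_space set \<Rightarrow> ('a, 'k::alg_closed_field) toric_point set \<Rightarrow>
     ('a, 'k) toric_point set \<Rightarrow> nat \<Rightarrow> bool" where
  "invariant_subvariety N X V c \<longleftrightarrow>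
     (\<exists>\<Sigma> \<sigma>. fan N \<Sigma> \<and> X = T_emb N \<Sigma> \<and> \<sigma> \<in> \<Sigma> \<and> dim \<sigma> = c \<and> V = orbit_closure N \<Sigma> \<sigma>)"

text \<open>
  Here \<open>\<sigma> + \<tau>\<close> is the elementwise sum of sets. The first part keeps the cones that are not replaced.
\<close>

definition star_subdivision ::
  "'a::euclidean_space set \<Rightarrow> 'a set set \<Rightarrow> 'a set \<Rightarrow> 'a set set" where
  "star_subdivision N \<Sigma> \<sigma> =
     (\<Sigma> - {\<sigma> + \<tau> | \<tau>. \<tau> \<in> \<Sigma> \<and> \<sigma> \<inter> \<tau> = {0} \<and> \<sigma> + \<tau> \<in> \<Sigma>}) \<union>
     {\<rho>. \<exists>\<tau>\<in>\<Sigma>. \<exists>x\<in>cone_gens N \<Sigma> \<sigma>. \<sigma> \<inter> \<tau> = {0} \<and> \<sigma> + \<tau> \<in> \<Sigma> \<and>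
        cone_face \<rho>
          (Cone ((cone_gens N \<Sigma> \<sigma> - {x}) \<union> {\<Sum>y\<in>cone_gens N \<Sigma> \<sigma>. y}) + \<tau>)}"

text \<open>
  \<open>equivariant_blow_up N Y \<phi> X V\<close>: \<open>\<phi> : Y \<rightarrow> X\<close> is the equivariant blow-up of \<open>X\<close> along \<open>V\<close>.
\<close>

definition equivariant_blow_up ::
  "'a::euclidean_space set \<Rightarrow> ('a, 'k::alg_closed_field) toric_point set \<Rightarrow>
     (('a, 'k) toric_point \<Rightarrow> ('a, 'k) toric_point) \<Rightarrow>
     ('a, 'k) toric_point set \<Rightarrow> ('a, 'k) toric_point set \<Rightarrow> bool" where
  "equivariant_blow_up N Y \<phi> X V \<longleftrightarrow>
     (\<exists>\<Sigma> \<sigma>. finite_complete_nonsingular_fan N \<Sigma> \<and> \<sigma> \<in> \<Sigma> \<and> 2 \<le> dim \<sigma> \<and>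
        X = T_emb N \<Sigma> \<and> V = orbit_closure N \<Sigma> \<sigma> \<and>
        Y = T_emb N (star_subdivision N \<Sigma> \<sigma>) \<and>
        \<phi> = toric_morphism N (star_subdivision N \<Sigma> \<sigma>) \<Sigma>)"

end

theory Submission
  imports Defs
begin

text \<open>
  A nonsingular fan is encoded by a simplicial complex on its set of primitive generators,
  namely the complex \<open>K\<close> of those sets of generators that span a cone of the fan
  (\<open>cone_complex\<close>). Faces of cones correspond to subsets, intersections of cones to intersections,
  and primitive collections are the minimal nonfaces of \<open>K\<close>. A complex whose faces are parts of
  lattice bases comes from a fan exactly if nonnegative coordinates supported on a face are unique
  (\<open>inj_comb\<close>, \<open>smooth_fan_of_complex\<close>).

  The star subdivision along the cone over \<open>P\<close> becomes the stellar subdivision of \<open>K\<close> at \<open>P\<close>, with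
  new vertex \<open>x = \<Sum>P\<close> (\<open>star_subdivision_eq\<close>). As the variety determines its fan
  (\<open>T_emb_inject\<close>), the first statement of the theorem says that \<open>K\<close> is such a stellar subdivision. The
  second one says that \<open>\<Sum>P = x\<close> for a minimal nonface \<open>P\<close>, and that any face through \<open>x\<close> stays a
  face when all of \<open>P\<close> is added to it and any one vector of \<open>P\<close> is taken out (\<open>absorbs\<close>). The third
  one is a reformulation of the second in terms of minimal nonfaces, which holds in any complex
  (\<open>absorbs_iff_PC\<close>).

  A stellar subdivision has the absorption property because a face through the new vertex is
  \<open>T \<union> {x}\<close> with \<open>T \<union> P\<close> a face of the original complex (\<open>star_subdivision_primitive\<close>). For the
  converse, each face \<open>S\<close> through \<open>x\<close> is replaced by \<open>(S - {x}) \<union> P\<close>. That this is again a complete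
  nonsingular fan rests on the relation \<open>\<Sum>P = x\<close>: it gives a unimodular exchange of \<open>x\<close> for a
  vector of \<open>P\<close>, and it translates coordinates on the new complex injectively into coordinates on
  \<open>K\<close>, by which uniqueness is inherited (\<open>transfer\<close>). Subdividing at \<open>P\<close> then returns \<open>K\<close>
  (\<open>star_down\<close>).
\<close>

section \<open>Cones and lattice bases\<close>

lemma in_Cone: "s \<in> S \<Longrightarrow> s \<in> Cone S"
  by (rule hull_inc)

lemma sum_in_Cone:
  assumes "\<And>s. s \<in> S \<Longrightarrow> 0 \<le> c s"
  shows "(\<Sum>s\<in>S. c s *\<^sub>R s) \<in> Cone S"
proof (cases "finite S")
  case True
  have "(\<Sum>s\<in>T. c s *\<^sub>R s) \<in> Cone S" if "finite T" "T \<subseteq> S" for T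
    using that
  proof (induction T)
    case empty then show ?case by (simp add: convex_cone_hull_contains_0)
  next
    case (insert t T)
    then have "(\<Sum>s\<in>T. c s *\<^sub>R s) \<in> Cone S" by simp
    moreover have "c t *\<^sub>R t \<in> Cone S"
      using insert.prems by (intro convex_cone_hull_mul in_Cone assms) auto
    ultimately show ?case
      using insert.hyps by (simp add: convex_cone_hull_add)
  qed
  then show ?thesis using True by blast
next
  case False
  then show ?thesis by (simp add: convex_cone_hull_contains_0)
qed

lemma sum_single:
  fixes b :: "'a::real_vector"
  assumes "finite S" "b \<in> S"
  shows "(\<Sum>s\<in>S. (if s = b then r else 0) *\<^sub>R s) = r *\<^sub>R b"
proof -
  have "(\<Sum>s\<in>S. (if s = b then r else 0) *\<^sub>R s) = (\<Sum>s\<in>S. if s = b then r *\<^sub>R s else 0)"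
    by (rule sum.cong) auto
  then show ?thesis using assms by simp
qed

lemma Cone_finite:
  fixes S :: "'a::euclidean_space set"
  assumes "finite S"
  shows "Cone S = {\<Sum>s\<in>S. c s *\<^sub>R s | c. \<forall>s. 0 \<le> c s}" (is "_ = ?R")
proof
  have S: "S \<subseteq> ?R"
  proof
    fix s assume "s \<in> S"
    then have "s = (\<Sum>t\<in>S. (if t = s then 1 else 0) *\<^sub>R t)"
      using sum_single[OF assms, of s 1] by simp
    then show "s \<in> ?R"
      by (intro CollectI exI[of _ "\<lambda>t. if t = s then 1 else 0"]) auto
  qed
  have 0: "0 \<in> ?R"
    by (rule CollectI, rule exI[of _ "\<lambda>_. 0"]) simp
  have add: "a + b \<in> ?R" if ab: "a \<in> ?R" "b \<in> ?R" for a b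
  proof -
    obtain c where "a = (\<Sum>s\<in>S. c s *\<^sub>R s)" "\<forall>s. 0 \<le> c s" using ab(1) by blast
    moreover obtain d where "b = (\<Sum>s\<in>S. d s *\<^sub>R s)" "\<forall>s. 0 \<le> d s" using ab(2) by blast
    ultimately show ?thesis
      by (intro CollectI exI[of _ "\<lambda>s. c s + d s"])
        (simp only: scaleR_left_distrib sum.distrib add_nonneg_nonneg simp_thms)
  qed
  have mul: "r *\<^sub>R a \<in> ?R" if a: "a \<in> ?R" "0 \<le> r" for a and r :: real
  proof -
    obtain c where "a = (\<Sum>s\<in>S. c s *\<^sub>R s)" "\<forall>s. 0 \<le> c s"
      using a(1) by blast
    then show ?thesis
      using a(2) by (intro CollectI exI[of _ "\<lambda>s. r * c s"])
        (simp only: scaleR_sum_right scaleR_scaleR mult_nonneg_nonneg simp_thms)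
  qed
  have "convex_cone ?R"
    unfolding convex_cone_iff using 0 add mul by (intro conjI ballI allI impI)
  then show "Cone S \<subseteq> ?R"
    using S by (intro hull_minimal)
  show "?R \<subseteq> Cone S"
    using sum_in_Cone[of S] by auto
qed

lemma Cone_Un: "Cone (A \<union> B) = Cone A + Cone B"
  unfolding convex_cone_hull_Un set_plus_def by blast

lemma Cone_mono: "A \<subseteq> B \<Longrightarrow> Cone A \<subseteq> Cone B"
  by (rule hull_mono)

lemma Cone_subset_span: "Cone S \<subseteq> span S"
  by (simp add: convex_cone_span hull_minimal span_superset)

lemma span_Cone: "span (Cone S) = span S"
  by (rule antisym) (simp_all add: span_minimal Cone_subset_span span_mono hull_subset)

lemma independent_coeffs_eq:
  fixes S :: "'a::euclidean_space set"
  assumes "independent S" "(\<Sum>s\<in>S. c s *\<^sub>R s) = (\<Sum>s\<in>S. d s *\<^sub>R s)" "s \<in> S"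
  shows "c s = d s"
proof -
  have "(\<Sum>s\<in>S. (c s - d s) *\<^sub>R s) = 0"
    using assms(2) by (simp add: scaleR_left_diff_distrib sum_subtractf)
  then have "c s - d s = 0"
    by (rule independentD[OF assms(1) independent_imp_finite[OF assms(1)] order_refl _ assms(3)])
  then show ?thesis by simp
qed

text \<open>
  Coordinates with respect to the generators are unique, so a vector of a simplicial cone lies in
  the cone over a subset of the generators iff its remaining coordinates vanish.
\<close>
lemma sum_in_Cone_subset_iff:
  fixes S :: "'a::euclidean_space set"
  assumes S: "independent S" and "A \<subseteq> S" and c: "\<And>s. s \<in> S \<Longrightarrow> 0 \<le> c s"
  shows "(\<Sum>s\<in>S. c s *\<^sub>R s) \<in> Cone A \<longleftrightarrow> (\<forall>s\<in>S - A. c s = 0)"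
proof
  assume "(\<Sum>s\<in>S. c s *\<^sub>R s) \<in> Cone A"
  then obtain d where "(\<Sum>s\<in>S. c s *\<^sub>R s) = (\<Sum>s\<in>A. d s *\<^sub>R s)"
    using Cone_finite[OF finite_subset[OF assms(2) independent_imp_finite[OF S]]] by blast
  also have "\<dots> = (\<Sum>s\<in>S. (if s \<in> A then d s else 0) *\<^sub>R s)"
    by (rule sum.mono_neutral_cong_left) (use independent_imp_finite[OF S] assms(2) in auto)
  finally have "c s = (if s \<in> A then d s else 0)" if "s \<in> S" for s
    by (rule independent_coeffs_eq[OF S _ that])
  then show "\<forall>s\<in>S - A. c s = 0" by simp
next
  assume "\<forall>s\<in>S - A. c s = 0"
  then have "(\<Sum>s\<in>S. c s *\<^sub>R s) = (\<Sum>s\<in>A. c s *\<^sub>R s)"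
    by (intro sum.mono_neutral_right) (use independent_imp_finite[OF S] assms(2) in auto)
  then show "(\<Sum>s\<in>S. c s *\<^sub>R s) \<in> Cone A"
    using sum_in_Cone[of A c, OF c[OF subsetD[OF assms(2)]]] by simp
qed

text \<open>
  A nonempty face is itself a cone, and with a vector it contains every summand of that vector, in
  particular each generator with positive coordinate; so it is generated by the generators in it.
  Conversely, if a point inside a segment of the cone has zero coordinates outside \<open>T\<close>, then so
  have the endpoints, since coordinates are nonnegative.
\<close>
lemma cone_face_simplicial_iff:
  fixes S :: "'a::euclidean_space set"
  assumes S: "independent S"
  shows "cone_face F (Cone S) \<longleftrightarrow> (\<exists>T\<subseteq>S. F = Cone T)"
proof
  have fin: "finite S" by (rule independent_imp_finite[OF S])
  assume F: "cone_face F (Cone S)"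
  then have FC: "F \<subseteq> Cone S" "convex F" "F \<noteq> {}"
    and face: "\<And>a b v. a \<in> Cone S \<Longrightarrow> b \<in> Cone S \<Longrightarrow> v \<in> F \<Longrightarrow> v \<in> open_segment a b \<Longrightarrow> a \<in> F \<and> b \<in> F"
    unfolding cone_face_def face_of_def by blast+
  \<comment> \<open>A summand of a face vector is in the face: \<open>a + b\<close> is the midpoint of \<open>2a\<close> and \<open>2b\<close>.\<close>
  have half: "2 *\<^sub>R a \<in> F" if "a \<in> Cone S" "b \<in> Cone S" "a + b \<in> F" for a b
  proof (cases "a = b")
    case False
    have "a + b \<in> open_segment (2 *\<^sub>R a) (2 *\<^sub>R b)"
      unfolding in_segment using False by (auto intro!: exI[of _ "1/2"])
    then show ?thesis
      using face that by (metis convex_cone_hull_mul zero_le_numeral)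
  qed (use that in \<open>simp add: scaleR_2\<close>)
  have 0: "0 \<in> F"
  proof -
    obtain v where v: "v \<in> F" using FC by blast
    then have "2 *\<^sub>R 0 \<in> F"
      using half[of 0 v] FC(1) by (auto simp: convex_cone_hull_contains_0)
    then show ?thesis by simp
  qed
  have down: "r *\<^sub>R a \<in> F" if "a \<in> F" "0 \<le> r" "r \<le> 1" for a and r :: real
    using FC(2) 0 that convexD_alt[of F 0 a r] by simp
  have pow: "2 ^ n *\<^sub>R a \<in> F" if "a \<in> F" for a n
  proof (induction n)
    case (Suc n)
    then have "2 *\<^sub>R (2 ^ n *\<^sub>R a) \<in> F"
      using half[of "2 ^ n *\<^sub>R a" 0] FC(1) by (auto simp: convex_cone_hull_contains_0)
    then show ?case by simp
  qed (use that in simp)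
  have mul: "r *\<^sub>R a \<in> F" if "a \<in> F" "0 \<le> r" for a and r :: real
  proof -
    obtain n where n: "r < 2 ^ n"
      using real_arch_pow[of 2 r] by auto
    then have "(r / 2 ^ n) *\<^sub>R (2 ^ n *\<^sub>R a) \<in> F"
      using down[OF pow[OF that(1)], of "r / 2 ^ n" n] that by simp
    then show ?thesis by simp
  qed
  have cone: "convex_cone F"
    unfolding convex_cone_def conic_def using FC mul by blast
  have "F = Cone (S \<inter> F)"
  proof
    show "Cone (S \<inter> F) \<subseteq> F"
      using cone by (simp add: hull_minimal)
    show "F \<subseteq> Cone (S \<inter> F)"
    proof
      fix v assume v: "v \<in> F"
      then obtain c where c: "v = (\<Sum>s\<in>S. c s *\<^sub>R s)" "\<forall>s. 0 \<le> c s"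
        using FC(1) Cone_finite[OF fin] by blast
      have "s \<in> F" if "s \<in> S" "c s \<noteq> 0" for s
      proof -
        have "v = c s *\<^sub>R s + (\<Sum>s\<in>S - {s}. c s *\<^sub>R s)"
          using c(1) that fin by (simp add: sum.remove)
        moreover have "(\<Sum>s\<in>S - {s}. c s *\<^sub>R s) \<in> Cone S"
          using sum_in_Cone[of "S - {s}" c] c(2) Cone_mono[of "S - {s}" S] by auto
        moreover have "c s *\<^sub>R s \<in> Cone S"
          using that c(2) by (simp add: convex_cone_hull_mul in_Cone)
        ultimately have "2 *\<^sub>R (c s *\<^sub>R s) \<in> F"
          using half v by blast
        then have "(1 / (2 * c s)) *\<^sub>R (2 *\<^sub>R (c s *\<^sub>R s)) \<in> F"
          by (rule mul) (simp add: c(2))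
        then show ?thesis using that by simp
      qed
      then show "v \<in> Cone (S \<inter> F)"
        unfolding c(1) using c(2) by (subst sum_in_Cone_subset_iff[OF S]) auto
    qed
  qed
  then show "\<exists>T\<subseteq>S. F = Cone T" by blast
next
  have fin: "finite S" by (rule independent_imp_finite[OF S])
  assume "\<exists>T\<subseteq>S. F = Cone T"
  then obtain T where T: "T \<subseteq> S" "F = Cone T" by blast
  have "a \<in> Cone T \<and> b \<in> Cone T"
    if ab: "a \<in> Cone S" "b \<in> Cone S" "v \<in> Cone T" "v \<in> open_segment a b" for a b v
  proof -
    obtain c where c: "a = (\<Sum>s\<in>S. c s *\<^sub>R s)" "\<forall>s. 0 \<le> c s"
      using Cone_finite[OF fin] ab by blast
    obtain d where d: "b = (\<Sum>s\<in>S. d s *\<^sub>R s)" "\<forall>s. 0 \<le> d s"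
      using Cone_finite[OF fin] ab by blast
    obtain u where u: "0 < u" "u < 1" "v = (1 - u) *\<^sub>R a + u *\<^sub>R b"
      using ab(4) in_segment by metis
    have v: "v = (\<Sum>s\<in>S. ((1 - u) * c s + u * d s) *\<^sub>R s)"
      unfolding u c(1) d(1)
      by (simp add: scaleR_sum_right sum.distrib scaleR_left_distrib)
    have "\<forall>s\<in>S - T. (1 - u) * c s + u * d s = 0"
      using ab(3) unfolding v
      by (subst (asm) sum_in_Cone_subset_iff[OF S T(1)]) (use u c d in auto)
    then have "\<forall>s\<in>S - T. c s = 0 \<and> d s = 0"
      using u c(2) d(2) by (simp add: add_nonneg_eq_0_iff)
    then show ?thesis
      unfolding c(1) d(1) using c(2) d(2)
      by (auto simp: sum_in_Cone_subset_iff[OF S T(1)])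
  qed
  then show "cone_face F (Cone S)"
    unfolding cone_face_def face_of_def T(2)
    using Cone_mono[OF T(1)] convex_cone_hull_nonempty convex_convex_cone_hull by blast
qed

lemma lattice_basis_coeffs:
  assumes "lattice_basis N B" "v \<in> N"
  obtains c where "v = (\<Sum>b\<in>B. real_of_int (c b) *\<^sub>R b)"
  using assms unfolding lattice_basis_def by blast

lemma lattice_basis_sum_in:
  assumes "lattice_basis N B"
  shows "(\<Sum>b\<in>B. real_of_int (c b) *\<^sub>R b) \<in> N"
  using assms unfolding lattice_basis_def by blast

lemma lattice_basis_subset: "lattice_basis N B \<Longrightarrow> B \<subseteq> N"
proof
  fix b assume B: "lattice_basis N B" and b: "b \<in> B"
  have "(\<Sum>a\<in>B. real_of_int (if a = b then 1 else 0) *\<^sub>R a)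
      = (\<Sum>a\<in>B. (if a = b then 1 else 0) *\<^sub>R a)"
    by (rule sum.cong) auto
  also have "\<dots> = b"
    using sum_single[of B b 1] B b unfolding lattice_basis_def by simp
  finally have "(\<Sum>a\<in>B. real_of_int (if a = b then 1 else 0) *\<^sub>R a) = b" .
  then show "b \<in> N" using lattice_basis_sum_in[OF B] by metis
qed

lemma lattice_basis_primitive:
  assumes B: "lattice_basis N B" and b: "b \<in> B"
  shows "primitive_vector N b"
proof -
  have fin: "finite B" and ind: "independent B"
    using B unfolding lattice_basis_def by auto
  have b0: "b \<noteq> 0"
    using ind b dependent_zero by blast
  have "k = 1" if w: "w \<in> N" "b = real k *\<^sub>R w" for w k
  proof -
    obtain c where c: "w = (\<Sum>a\<in>B. real_of_int (c a) *\<^sub>R a)"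
      using lattice_basis_coeffs[OF B w(1)] .
    have "(\<Sum>a\<in>B. (if a = b then 1 else 0) *\<^sub>R a) = b"
      using sum_single[OF fin b, of 1] by simp
    also have "b = (\<Sum>a\<in>B. (real k * real_of_int (c a)) *\<^sub>R a)"
      using w(2) unfolding c by (simp add: scaleR_sum_right)
    finally have "(if b = b then 1 else 0) = real k * real_of_int (c b)"
      by (rule independent_coeffs_eq[OF ind _ b])
    then have "1 = real k * real_of_int (c b)" by simp
    then have "int k * c b = 1"
      by (metis of_int_1 of_int_eq_iff of_int_mult of_int_of_nat_eq)
    then show "k = 1"
      using zmult_eq_1_iff[of "int k" "c b"] by simp
  qed
  then show ?thesis
    unfolding primitive_vector_def using lattice_basis_subset[OF B] b b0 by blast
qed

text \<open>
  The factor \<open>t\<close> is a coordinate of a lattice vector, hence an integer, and primitivity forces it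
  to be 1. This is what makes the generators of a nonsingular cone recoverable from the cone.
\<close>
lemma primitive_on_basis_ray:
  assumes B: "lattice_basis N B" and b: "b \<in> B" and v: "primitive_vector N v"
    and t: "v = t *\<^sub>R b" "0 \<le> t"
  shows "v = b"
proof -
  have fin: "finite B" and ind: "independent B"
    using B unfolding lattice_basis_def by auto
  obtain c where c: "v = (\<Sum>a\<in>B. real_of_int (c a) *\<^sub>R a)"
    using lattice_basis_coeffs[OF B] v unfolding primitive_vector_def by metis
  have "(\<Sum>a\<in>B. (if a = b then t else 0) *\<^sub>R a) = v"
    using sum_single[OF fin b, of t] t by simp
  also note c
  finally have "(if b = b then t else 0) = real_of_int (c b)"
    by (rule independent_coeffs_eq[OF ind _ b])
  then have "t = real (nat (c b))" using t(2) by simp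
  then have "nat (c b) = 1"
    using v t(1) lattice_basis_subset[OF B] b unfolding primitive_vector_def by blast
  then show ?thesis using t \<open>t = real (nat (c b))\<close> by simp
qed

text \<open>
  An elementary unimodular change of basis; it covers both the replacement of a member of
  \<open>P\<close> by \<open>\<Sum>P\<close> and the reverse replacement.
\<close>

lemma lattice_basis_exchange:
  assumes B: "lattice_basis N B" and b: "b \<in> B"
    and v: "v = b + (\<Sum>a\<in>B - {b}. real_of_int (k a) *\<^sub>R a)"
  shows "lattice_basis N (insert v (B - {b}))"
proof -
  have fin: "finite B" and ind: "independent B"
    and N: "N = {\<Sum>b\<in>B. real_of_int (c b) *\<^sub>R b | c. True}"
    using B unfolding lattice_basis_def by auto
  let ?C = "B - {b}"
  have sp: "(\<Sum>a\<in>?C. real_of_int (k a) *\<^sub>R a) \<in> span ?C"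
    by (intro span_sum span_scale span_base)
  have bsp: "b \<notin> span ?C"
    using ind b dependent_def by blast
  have vsp: "v \<notin> span ?C"
  proof
    assume "v \<in> span ?C"
    from span_diff[OF this sp] show False
      using bsp unfolding v by simp
  qed
  then have vC: "v \<notin> ?C" using span_base[of v ?C] by blast
  have ind': "independent (insert v ?C)"
    using independent_insertI[OF vsp independent_mono[OF ind]] by blast
  have eq: "(\<Sum>a\<in>insert v ?C. real_of_int (c a) *\<^sub>R a)
      = (\<Sum>a\<in>B. real_of_int (if a = b then c v else c a + c v * k a) *\<^sub>R a)" for c
  proof -
    have "(\<Sum>a\<in>insert v ?C. real_of_int (c a) *\<^sub>R a)
        = real_of_int (c v) *\<^sub>R v + (\<Sum>a\<in>?C. real_of_int (c a) *\<^sub>R a)"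
      using vC fin by simp
    also have "\<dots> = real_of_int (c v) *\<^sub>R b + (\<Sum>a\<in>?C. real_of_int (c a + c v * k a) *\<^sub>R a)"
      unfolding v by (simp add: scaleR_right_distrib scaleR_sum_right scaleR_left_distrib sum.distrib)
    also have "\<dots> = real_of_int (c v) *\<^sub>R b
        + (\<Sum>a\<in>?C. real_of_int (if a = b then c v else c a + c v * k a) *\<^sub>R a)"
      by (intro arg_cong2[of _ _ _ _ "(+)"] sum.cong) auto
    also have "\<dots> = (\<Sum>a\<in>B. real_of_int (if a = b then c v else c a + c v * k a) *\<^sub>R a)"
      using b fin by (simp add: sum.remove)
    finally show ?thesis .
  qed
  have "N = {\<Sum>a\<in>insert v ?C. real_of_int (c a) *\<^sub>R a | c. True}" (is "_ = ?R")
  proof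
    show "?R \<subseteq> N" using lattice_basis_sum_in[OF B] by (auto simp only: eq)
    show "N \<subseteq> ?R"
    proof
      fix w assume "w \<in> N"
      then obtain c where c: "w = (\<Sum>a\<in>B. real_of_int (c a) *\<^sub>R a)" using N by blast
      \<comment> \<open>The coefficient of \<open>b\<close> moves to \<open>v\<close>; the other coordinates of \<open>v\<close> are corrected for.\<close>
      define e where "e a = (if a = v then c b else c a - c b * k a)" for a
      have "(\<Sum>a\<in>B. real_of_int (c a) *\<^sub>R a)
          = (\<Sum>a\<in>B. real_of_int (if a = b then e v else e a + e v * k a) *\<^sub>R a)"
        using vC by (intro sum.cong) (auto simp: e_def)
      then have "w = (\<Sum>a\<in>insert v ?C. real_of_int (e a) *\<^sub>R a)"
        unfolding c eq[of e] .
      then show "w \<in> ?R" by blast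
    qed
  qed
  then show ?thesis
    unfolding lattice_basis_def using ind' fin by simp
qed

definition basis_part :: "'a::euclidean_space set \<Rightarrow> 'a set \<Rightarrow> bool" where
  "basis_part N S \<longleftrightarrow> (\<exists>B. lattice_basis N B \<and> S \<subseteq> B)"

lemma basis_part_subset: "basis_part N S \<Longrightarrow> T \<subseteq> S \<Longrightarrow> basis_part N T"
  unfolding basis_part_def by blast

lemma basis_part_independent: "basis_part N S \<Longrightarrow> independent S"
  unfolding basis_part_def lattice_basis_def using independent_mono by blast

lemma basis_part_finite: "basis_part N S \<Longrightarrow> finite S"
  using basis_part_independent independent_imp_finite by blast

lemma basis_part_lattice: "basis_part N S \<Longrightarrow> S \<subseteq> N"
  unfolding basis_part_def using lattice_basis_subset by blast

text \<open>
  A cone created by a star subdivision is generated by \<open>\<Sum>P\<close> and by generators of an old cone, one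
  vector of \<open>P\<close> being left out; this exchange makes it nonsingular.
\<close>
lemma basis_part_barycentre:
  assumes "basis_part N (S \<union> P)" and "y \<in> P" "y \<notin> S"
  shows "basis_part N (insert (\<Sum>P) (S \<union> P - {y}))"
proof -
  obtain B where B: "lattice_basis N B" "S \<union> P \<subseteq> B"
    using assms(1) unfolding basis_part_def by blast
  have fin: "finite B" using B unfolding lattice_basis_def by blast
  then have finP: "finite P" using B(2) finite_subset by blast
  have "\<Sum>P = y + \<Sum>(P - {y})"
    by (rule sum.remove[OF finP assms(2)])
  also have "\<Sum>(P - {y}) = (\<Sum>a\<in>B - {y}. real_of_int (if a \<in> P then 1 else 0) *\<^sub>R a)"
    by (rule sum.mono_neutral_cong_left) (use fin B(2) in auto)
  finally have "lattice_basis N (insert (\<Sum>P) (B - {y}))"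
    by (rule lattice_basis_exchange[OF B(1), rotated]) (use assms(2) B(2) in blast)
  then show ?thesis
    unfolding basis_part_def using B(2) by (intro exI conjI) auto
qed

text \<open>
  The reverse exchange, which gives the nonsingularity of the cones created by blowing down.
\<close>
lemma basis_part_unbarycentre:
  assumes "basis_part N (insert (\<Sum>P) (S \<union> (P - {y})))" and "y \<in> P" "\<Sum>P \<notin> S" "\<Sum>P \<notin> P" "finite P"
  shows "basis_part N (S \<union> P)"
proof -
  let ?x = "\<Sum>P"
  obtain B where B: "lattice_basis N B" "insert ?x (S \<union> (P - {y})) \<subseteq> B"
    using assms(1) unfolding basis_part_def by blast
  have fin: "finite B" using B unfolding lattice_basis_def by blast
  have "y = ?x + - \<Sum>(P - {y})"
    using sum.remove[OF assms(5,2), of "\<lambda>a. a"] by simp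
  also have "- \<Sum>(P - {y}) = (\<Sum>a\<in>B - {?x}. real_of_int (if a \<in> P - {y} then -1 else 0) *\<^sub>R a)"
    unfolding sum_negf[symmetric]
    by (rule sum.mono_neutral_cong_left) (use fin B(2) assms in auto)
  finally have "lattice_basis N (insert y (B - {?x}))"
    by (rule lattice_basis_exchange[OF B(1), rotated]) (use B(2) in blast)
  then show ?thesis
    unfolding basis_part_def using B(2) assms by (intro exI conjI) auto
qed

section \<open>Nonsingular fans as simplicial complexes\<close>

definition comb :: "('a::euclidean_space \<Rightarrow> real) \<Rightarrow> 'a" where
  "comb c = (\<Sum>s | c s \<noteq> 0. c s *\<^sub>R s)"

text \<open>
  The candidate coordinate vectors for a complex \<open>K\<close>. In a fan with generator complex \<open>K\<close>, every
  vector of the support has exactly one such coordinate vector; see \<open>inj_comb\<close> and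
  \<open>smooth_fan_of_complex\<close>.
\<close>
definition coords :: "'a::euclidean_space set set \<Rightarrow> ('a \<Rightarrow> real) set" where
  "coords K = {c. (\<forall>s. 0 \<le> c s) \<and> {s. c s \<noteq> 0} \<in> K}"

definition cone_complex :: "'a::euclidean_space set \<Rightarrow> 'a set set \<Rightarrow> 'a set set" where
  "cone_complex N \<Sigma> = {S. S \<subseteq> fan_gens N \<Sigma> \<and> Cone S \<in> \<Sigma>}"

lemma comb_eq_sum: "finite S \<Longrightarrow> {s. c s \<noteq> 0} \<subseteq> S \<Longrightarrow> comb c = (\<Sum>s\<in>S. c s *\<^sub>R s)"
  unfolding comb_def by (rule sum.mono_neutral_left) auto

lemma Cone_eq_comb:
  assumes "finite S"
  shows "Cone S = comb ` {c. (\<forall>s. 0 \<le> c s) \<and> {s. c s \<noteq> 0} \<subseteq> S}" (is "_ = comb ` ?C")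
proof
  show "Cone S \<subseteq> comb ` ?C"
  proof
    fix v assume "v \<in> Cone S"
    then obtain c where c: "v = (\<Sum>s\<in>S. c s *\<^sub>R s)" "\<forall>s. 0 \<le> c s"
      unfolding Cone_finite[OF assms] by auto
    define d where "d s = (if s \<in> S then c s else 0)" for s
    have "v = (\<Sum>s\<in>S. d s *\<^sub>R s)"
      unfolding c(1) d_def by (rule sum.cong) auto
    also have "\<dots> = comb d"
      by (rule comb_eq_sum[OF assms, symmetric]) (auto simp: d_def)
    finally have v: "v = comb d" .
    have "d \<in> ?C" using c(2) by (auto simp: d_def)
    then show "v \<in> comb ` ?C" unfolding v by (rule imageI)
  qed
  show "comb ` ?C \<subseteq> Cone S"
    using sum_in_Cone[of S] comb_eq_sum[OF assms] by auto
qed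

lemma dim_Cone: "independent S \<Longrightarrow> dim (Cone S) = card S"
  by (metis dim_eq_card_independent dim_span span_Cone)

lemma Cone_insert_subset: "v \<in> Cone S \<Longrightarrow> Cone {v} \<subseteq> Cone S"
  by (rule hull_minimal) (simp_all add: convex_cone_convex_cone_hull)

lemma Cone_pointed:
  fixes S :: "'a::euclidean_space set"
  assumes "independent S"
  shows "Cone S \<inter> uminus ` Cone S = {0}"
proof (rule antisym)
  show "{0} \<subseteq> Cone S \<inter> uminus ` Cone S"
    using convex_cone_hull_contains_0[of S] by (auto simp: image_iff)
  show "Cone S \<inter> uminus ` Cone S \<subseteq> {0}"
  proof clarify
    fix w assume w: "w \<in> Cone S" and "- w \<in> Cone S"
    then obtain c d where c: "w = (\<Sum>s\<in>S. c s *\<^sub>R s)" "\<forall>s. 0 \<le> c s"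
      and d: "- w = (\<Sum>s\<in>S. d s *\<^sub>R s)" "\<forall>s. 0 \<le> d s"
      unfolding Cone_finite[OF independent_imp_finite[OF assms]] by auto
    have "(\<Sum>s\<in>S. (c s + d s) *\<^sub>R s) = w + - w"
      unfolding c(1) d(1) by (simp add: scaleR_left_distrib sum.distrib flip: c(1) d(1))
    then have eq: "(\<Sum>s\<in>S. (c s + d s) *\<^sub>R s) = (\<Sum>s\<in>S. 0 *\<^sub>R s)"
      by simp
    have "c s = 0" if "s \<in> S" for s
      using independent_coeffs_eq[OF assms eq that] c(2) d(2) by (simp add: add_nonneg_eq_0_iff)
    then show "- w = 0" unfolding c(1) by simp
  qed
qed

locale smooth_fan =
  fixes N :: "'a::euclidean_space set" and \<Sigma> :: "'a set set"
  assumes fan: "fan N \<Sigma>" and nonsingular: "nonsingular_fan N \<Sigma>"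
begin

abbreviation "K \<equiv> cone_complex N \<Sigma>"

lemma face_in: "\<sigma> \<in> \<Sigma> \<Longrightarrow> cone_face \<tau> \<sigma> \<Longrightarrow> \<tau> \<in> \<Sigma>"
  using fan unfolding fan_def by blast

lemma inter_face:
  assumes "\<sigma> \<in> \<Sigma>" "\<tau> \<in> \<Sigma>"
  shows "cone_face (\<sigma> \<inter> \<tau>) \<sigma>" "cone_face (\<sigma> \<inter> \<tau>) \<tau>"
  using fan assms unfolding fan_def by blast+

lemma subset_Cone_in:
  assumes "basis_part N S" "Cone S \<in> \<Sigma>" "T \<subseteq> S"
  shows "Cone T \<in> \<Sigma>"
  using face_in[OF assms(2)] cone_face_simplicial_iff[OF basis_part_independent[OF assms(1)]] assms(3)
  by blast

text \<open>
  The minimal generators of a nonsingular cone of the fan are a datum of the fan: a generator spans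
  a face, hence a ray of the fan; a ray of the fan inside the cone meets it in a face, so it is the
  ray of some generator, and primitivity fixes the vector on that ray.
\<close>
lemma cone_gens_Cone:
  assumes S: "basis_part N S" "Cone S \<in> \<Sigma>"
  shows "cone_gens N \<Sigma> (Cone S) = S"
proof
  have ind: "independent S" by (rule basis_part_independent[OF S(1)])
  obtain B where B: "lattice_basis N B" "S \<subseteq> B"
    using S(1) unfolding basis_part_def by blast
  show "S \<subseteq> cone_gens N \<Sigma> (Cone S)"
  proof
    fix s assume s: "s \<in> S"
    have "independent {s}" using independent_mono[OF ind, of "{s}"] s by blast
    then have "dim (Cone {s}) = 1" by (simp add: dim_Cone)
    moreover have "Cone {s} \<in> \<Sigma>" using subset_Cone_in[OF S, of "{s}"] s by blast
    moreover have "primitive_vector N s"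
      using lattice_basis_primitive[OF B(1)] B(2) s by blast
    ultimately show "s \<in> cone_gens N \<Sigma> (Cone S)"
      unfolding cone_gens_def fan_gens_def using in_Cone[OF s] by blast
  qed
  show "cone_gens N \<Sigma> (Cone S) \<subseteq> S"
  proof
    fix v assume "v \<in> cone_gens N \<Sigma> (Cone S)"
    then have v: "v \<in> Cone S" "primitive_vector N v" "Cone {v} \<in> \<Sigma>"
      unfolding cone_gens_def fan_gens_def by blast+
    have v0: "v \<noteq> 0" using v(2) unfolding primitive_vector_def by blast
    have "Cone S \<inter> Cone {v} = Cone {v}"
      using Cone_insert_subset[OF v(1)] by blast
    then have "cone_face (Cone {v}) (Cone S)"
      using inter_face(1)[OF S(2) v(3)] by simp
    then obtain T where T: "T \<subseteq> S" "Cone {v} = Cone T"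
      using cone_face_simplicial_iff[OF ind] by blast
    have "T \<noteq> {}"
      using T(2) v0 in_Cone[of v "{v}"] by (auto simp: convex_cone_hull_empty)
    then obtain t where t: "t \<in> T" by blast
    have "t \<in> Cone {v}" using in_Cone[OF t] T(2) by simp
    then obtain c where c: "t = c v *\<^sub>R v" "0 \<le> c v"
      by (auto simp: Cone_finite)
    have "t \<noteq> 0" using ind T(1) t dependent_zero by blast
    then have "v = (1 / c v) *\<^sub>R t" "0 \<le> 1 / c v" using c by auto
    then have "v = t"
      using primitive_on_basis_ray[OF B(1) _ v(2)] B(2) T(1) t by blast
    then show "v \<in> S" using T(1) t by blast
  qed
qed

lemma complexI: "basis_part N S \<Longrightarrow> Cone S \<in> \<Sigma> \<Longrightarrow> S \<in> K"
  using cone_gens_Cone unfolding cone_complex_def cone_gens_def by blast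

lemma complex_Cone: "S \<in> K \<Longrightarrow> Cone S \<in> \<Sigma>"
  unfolding cone_complex_def by blast

lemma complex_gens: "S \<in> K \<Longrightarrow> S \<subseteq> fan_gens N \<Sigma>"
  unfolding cone_complex_def by blast

lemma complex_iff: "S \<subseteq> fan_gens N \<Sigma> \<Longrightarrow> S \<in> K \<longleftrightarrow> Cone S \<in> \<Sigma>"
  unfolding cone_complex_def by blast

lemma cone_generated:
  assumes "\<sigma> \<in> \<Sigma>"
  obtains S where "S \<in> K" "\<sigma> = Cone S"
  using assms nonsingular complexI unfolding nonsingular_fan_def basis_part_def by metis

lemma complex_basis_part:
  assumes S: "S \<in> K"
  shows "basis_part N S"
proof -
  obtain B T where T: "lattice_basis N B" "T \<subseteq> B" "Cone S = Cone T"
    using complex_Cone[OF S] nonsingular unfolding nonsingular_fan_def by blast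
  then have bp: "basis_part N T" unfolding basis_part_def by blast
  have "S \<subseteq> cone_gens N \<Sigma> (Cone S)"
    using complex_gens[OF S] in_Cone[of _ S] unfolding cone_gens_def by blast
  also have "\<dots> = T"
    using cone_gens_Cone[OF bp] complex_Cone[OF S] T(3) by simp
  finally show ?thesis by (rule basis_part_subset[OF bp])
qed

lemma complex_independent: "S \<in> K \<Longrightarrow> independent S"
  using complex_basis_part basis_part_independent by blast

lemma complex_finite: "S \<in> K \<Longrightarrow> finite S"
  using complex_basis_part basis_part_finite by blast

lemma cone_gens_complex: "S \<in> K \<Longrightarrow> cone_gens N \<Sigma> (Cone S) = S"
  using cone_gens_Cone complex_basis_part complex_Cone by blast

lemma Cone_eq_iff: "S \<in> K \<Longrightarrow> T \<in> K \<Longrightarrow> Cone S = Cone T \<longleftrightarrow> S = T"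
  using cone_gens_complex by metis

lemma fan_eq_image: "\<Sigma> = Cone ` K"
  using cone_generated complex_Cone by blast

lemma complex_down:
  assumes "S \<in> K" "T \<subseteq> S"
  shows "T \<in> K"
  using subset_Cone_in[OF complex_basis_part[OF assms(1)] complex_Cone[OF assms(1)] assms(2)]
    complex_gens[OF assms(1)] assms(2) unfolding cone_complex_def by blast

lemma complex_empty: "{} \<in> K"
proof -
  obtain \<sigma> where "\<sigma> \<in> \<Sigma>" using fan unfolding fan_def by blast
  then obtain S where "S \<in> K" using cone_generated by blast
  then show ?thesis using complex_down by blast
qed

lemma complex_face:
  assumes "S \<in> K"
  shows "cone_face F (Cone S) \<longleftrightarrow> (\<exists>T\<subseteq>S. F = Cone T)"
  by (rule cone_face_simplicial_iff[OF complex_independent[OF assms]])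

text \<open>
  The intersection is a common face, hence it is generated by a subset of \<open>S\<close> and by a subset of
  \<open>T\<close>; these two subsets are equal because a cone determines its generators.
\<close>
lemma Cone_inter:
  assumes S: "S \<in> K" and T: "T \<in> K"
  shows "Cone S \<inter> Cone T = Cone (S \<inter> T)"
proof
  obtain C where C: "C \<subseteq> S" "Cone S \<inter> Cone T = Cone C"
    using inter_face(1)[OF complex_Cone[OF S] complex_Cone[OF T]] complex_face[OF S] by blast
  obtain D where D: "D \<subseteq> T" "Cone S \<inter> Cone T = Cone D"
    using inter_face(2)[OF complex_Cone[OF S] complex_Cone[OF T]] complex_face[OF T] by blast
  have "C = D"
    using Cone_eq_iff[OF complex_down[OF S C(1)] complex_down[OF T D(1)]] C(2) D(2) by blast
  then have "C \<subseteq> S \<inter> T" using C(1) D(1) by blast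
  then show "Cone S \<inter> Cone T \<subseteq> Cone (S \<inter> T)"
    unfolding C(2) by (rule Cone_mono)
  show "Cone (S \<inter> T) \<subseteq> Cone S \<inter> Cone T"
    using Cone_mono[of "S \<inter> T" S] Cone_mono[of "S \<inter> T" T] by blast
qed

text \<open>
  A vector with coordinates supported on \<open>S\<close> and on \<open>T\<close> lies in the cone over \<open>S \<inter> T\<close>. Since all
  its coordinates on \<open>S\<close> are nonzero, \<open>S \<subseteq> T\<close>, and by symmetry the supports agree.
\<close>
lemma inj_comb: "inj_on comb (coords K)"
proof
  fix c d assume c: "c \<in> coords K" and d: "d \<in> coords K" and eq: "comb c = comb d"
  have sub: "{s. c s \<noteq> 0} \<subseteq> {s. d s \<noteq> 0}"
    if c: "c \<in> coords K" and d: "d \<in> coords K" and eq: "comb c = comb d" for c d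
  proof -
    let ?S = "{s. c s \<noteq> 0}" and ?T = "{s. d s \<noteq> 0}"
    have S: "?S \<in> K" and T: "?T \<in> K" and pos: "\<And>s. 0 \<le> c s" "\<And>s. 0 \<le> d s"
      using c d unfolding coords_def by auto
    have "comb c \<in> Cone ?S" unfolding comb_def by (rule sum_in_Cone) (rule pos)
    moreover have "comb c \<in> Cone ?T" unfolding eq unfolding comb_def by (rule sum_in_Cone) (rule pos)
    ultimately have "comb c \<in> Cone (?S \<inter> ?T)"
      unfolding Cone_inter[OF S T, symmetric] by (rule IntI)
    then have "\<forall>s\<in>?S - (?S \<inter> ?T). c s = 0"
      unfolding comb_def
      by (subst (asm) sum_in_Cone_subset_iff[OF complex_independent[OF S] Int_lower1]) (rule pos)
    then show ?thesis by blast
  qed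
  have ST: "{s. c s \<noteq> 0} = {s. d s \<noteq> 0}"
    using sub[OF c d eq] sub[OF d c eq[symmetric]] by blast
  have "{s. c s \<noteq> 0} \<in> K" using c unfolding coords_def by blast
  then have ind: "independent {s. c s \<noteq> 0}" by (rule complex_independent)
  have eq': "(\<Sum>s | c s \<noteq> 0. c s *\<^sub>R s) = (\<Sum>s | c s \<noteq> 0. d s *\<^sub>R s)"
    using eq unfolding comb_def ST .
  show "c = d"
  proof
    fix s show "c s = d s"
    proof (cases "c s = 0")
      case True
      then show ?thesis using ST by auto
    next
      case False
      then show ?thesis using independent_coeffs_eq[OF ind eq', of s] by blast
    qed
  qed
qed

lemma complex_eqI:
  assumes "\<And>S. S \<in> L \<Longrightarrow> basis_part N S" and "\<Sigma> = Cone ` L"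
  shows "K = L"
proof
  show LK: "L \<subseteq> K"
  proof
    fix S assume "S \<in> L"
    then show "S \<in> K" using complexI[OF assms(1)] assms(2) by simp
  qed
  show "K \<subseteq> L"
  proof
    fix S assume S: "S \<in> K"
    then obtain T where T: "T \<in> L" "Cone S = Cone T"
      using complex_Cone[OF S] assms(2) by auto
    then have "S = T" using Cone_eq_iff[OF S, of T] LK by auto
    then show "S \<in> L" using T(1) by simp
  qed
qed

end

text \<open>
  The converse of \<open>inj_comb\<close>: uniqueness of coordinates makes any two cones meet in the cone over
  the common generators, which yields the fan axiom on pairs of cones.
\<close>
lemma smooth_fan_of_complex:
  assumes ne: "{} \<in> L" and down: "\<And>S T. S \<in> L \<Longrightarrow> T \<subseteq> S \<Longrightarrow> T \<in> L"
    and bp: "\<And>S. S \<in> L \<Longrightarrow> basis_part N S" and inj: "inj_on comb (coords L)"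
  shows "smooth_fan N (Cone ` L)"
proof
  have inter: "Cone S \<inter> Cone T = Cone (S \<inter> T)" if S: "S \<in> L" and T: "T \<in> L" for S T
  proof
    show "Cone (S \<inter> T) \<subseteq> Cone S \<inter> Cone T"
      using Cone_mono[of "S \<inter> T" S] Cone_mono[of "S \<inter> T" T] by blast
    show "Cone S \<inter> Cone T \<subseteq> Cone (S \<inter> T)"
    proof
      fix v assume v: "v \<in> Cone S \<inter> Cone T"
      have fin: "finite S" "finite T" using basis_part_finite bp S T by blast+
      obtain c where c: "v = comb c" "\<forall>s. 0 \<le> c s" "{s. c s \<noteq> 0} \<subseteq> S"
        using v unfolding Cone_eq_comb[OF fin(1)] by blast
      obtain d where d: "v = comb d" "\<forall>s. 0 \<le> d s" "{s. d s \<noteq> 0} \<subseteq> T"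
        using v unfolding Cone_eq_comb[OF fin(2)] by blast
      have "c \<in> coords L" "d \<in> coords L"
        unfolding coords_def using c d down[OF S] down[OF T] by blast+
      then have "c = d" using inj_onD[OF inj] c(1) d(1) by metis
      then show "v \<in> Cone (S \<inter> T)"
        unfolding Cone_eq_comb[OF finite_Int[OF disjI1[OF fin(1)]]] using c d by blast
    qed
  qed
  have face: "cone_face F (Cone S) \<longleftrightarrow> (\<exists>T\<subseteq>S. F = Cone T)" if "S \<in> L" for F S
    by (rule cone_face_simplicial_iff[OF basis_part_independent[OF bp[OF that]]])
  have "scrp_cone N (Cone S)" if "S \<in> L" for S
    unfolding scrp_cone_def using Cone_pointed[OF basis_part_independent[OF bp[OF that]]]
      basis_part_finite[OF bp[OF that]] basis_part_lattice[OF bp[OF that]] by blast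
  moreover have "\<tau> \<in> Cone ` L" if "S \<in> L" "cone_face \<tau> (Cone S)" for S \<tau>
    using that face down by blast
  moreover have "cone_face (Cone S \<inter> Cone T) (Cone S)" "cone_face (Cone S \<inter> Cone T) (Cone T)"
    if "S \<in> L" "T \<in> L" for S T
    unfolding inter[OF that] face[OF that(1)] face[OF that(2)] by blast+
  ultimately show "fan N (Cone ` L)"
    unfolding fan_def using ne by blast
  show "nonsingular_fan N (Cone ` L)"
    unfolding nonsingular_fan_def using bp unfolding basis_part_def by blast
qed

section \<open>Star subdivisions of complexes\<close>

text \<open>
  The stellar subdivision of a simplicial complex at the face \<open>P\<close>, whose new vertex is the vector
  \<open>\<Sum>P\<close>.
\<close>
definition star_complex :: "'a::euclidean_space set set \<Rightarrow> 'a set \<Rightarrow> 'a set set" where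
  "star_complex K P =
     {S \<in> K. \<not> P \<subseteq> S} \<union> {insert (\<Sum>P) S | S. S \<in> K \<and> \<not> P \<subseteq> S \<and> S \<union> P \<in> K}"

context smooth_fan
begin

text \<open>
  All coordinates of \<open>\<Sum>P\<close> on \<open>P\<close> are nonzero, so it lies in no proper face of the cone over \<open>P\<close>.
\<close>
lemma barycentre_in_Cone:
  assumes P: "P \<in> K" and S: "S \<in> K" and x: "\<Sum>P \<in> Cone S"
  shows "P \<subseteq> S"
proof -
  have eq: "(\<Sum>p\<in>P. 1 *\<^sub>R p) = \<Sum>P" by simp
  have "\<Sum>P \<in> Cone P" using sum_in_Cone[of P "\<lambda>_. 1"] by simp
  then have "\<Sum>P \<in> Cone (P \<inter> S)"
    using x unfolding Cone_inter[OF P S, symmetric] by (rule IntI)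
  then have "(\<Sum>p\<in>P. 1 *\<^sub>R p) \<in> Cone (P \<inter> S)" unfolding eq .
  then have "\<forall>p\<in>P - (P \<inter> S). (1::real) = 0"
    by (subst (asm) sum_in_Cone_subset_iff[OF complex_independent[OF P] Int_lower1]) auto
  then show ?thesis by auto
qed

lemma star_complex_basis_part:
  assumes "S \<in> star_complex K P"
  shows "basis_part N S"
proof -
  consider "S \<in> K" | T where "S = insert (\<Sum>P) T" "\<not> P \<subseteq> T" "T \<union> P \<in> K"
    using assms unfolding star_complex_def by blast
  then show ?thesis
  proof cases
    case 1
    then show ?thesis by (rule complex_basis_part)
  next
    case 2
    then obtain y where y: "y \<in> P" "y \<notin> T" by blast
    have "basis_part N (insert (\<Sum>P) (T \<union> P - {y}))"
      by (rule basis_part_barycentre[OF complex_basis_part[OF 2(3)] y])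
    then show ?thesis
      by (rule basis_part_subset) (use y 2(1) in blast)
  qed
qed

text \<open>
  The cones \<open>\<sigma> + \<tau>\<close> with \<open>\<sigma> \<inter> \<tau> = 0\<close> are exactly the cones of the fan that contain \<open>\<sigma>\<close>, as
  \<open>\<tau>\<close> can be generated by the generators outside \<open>\<sigma>\<close>. The cones that replace them are again
  simplicial, so that their faces are given by sets of generators.
\<close>
lemma star_subdivision_eq:
  assumes P: "P \<in> K"
  shows "star_subdivision N \<Sigma> (Cone P) = Cone ` star_complex K P"
proof -
  let ?x = "\<Sum>P"
  have disj: "Cone P \<inter> Cone T = {0} \<longleftrightarrow> P \<inter> T = {}" if T: "T \<in> K" for T
  proof -
    have "Cone P \<inter> Cone T = {0} \<longleftrightarrow> Cone (P \<inter> T) = Cone {}"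
      unfolding Cone_inter[OF P T] by (simp add: convex_cone_hull_empty)
    then show ?thesis
      using Cone_eq_iff[OF complex_down[OF P Int_lower1] complex_empty] by simp
  qed
  have join: "Cone P + Cone T \<in> \<Sigma> \<longleftrightarrow> P \<union> T \<in> K" if "T \<in> K" for T
    unfolding Cone_Un[symmetric] using complex_iff[of "P \<union> T"] complex_gens[OF P] complex_gens[OF that]
    by simp
  have removed: "{Cone P + \<tau> | \<tau>. \<tau> \<in> \<Sigma> \<and> Cone P \<inter> \<tau> = {0} \<and> Cone P + \<tau> \<in> \<Sigma>}
      = Cone ` {S \<in> K. P \<subseteq> S}" (is "?A = ?B")
  proof
    show "?A \<subseteq> ?B"
    proof
      fix \<rho> assume "\<rho> \<in> ?A"
      then obtain \<tau> where \<tau>: "\<rho> = Cone P + \<tau>" "\<tau> \<in> \<Sigma>" "Cone P + \<tau> \<in> \<Sigma>" by blast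
      obtain T where T: "T \<in> K" "\<tau> = Cone T" using cone_generated[OF \<tau>(2)] .
      have "P \<union> T \<in> K" using join[OF T(1)] \<tau>(3) T(2) by simp
      moreover have "\<rho> = Cone (P \<union> T)" unfolding \<tau>(1) T(2) Cone_Un ..
      ultimately show "\<rho> \<in> ?B" by blast
    qed
    show "?B \<subseteq> ?A"
    proof
      fix \<rho> assume "\<rho> \<in> ?B"
      then obtain S where S: "S \<in> K" "P \<subseteq> S" "\<rho> = Cone S" by blast
      have T: "S - P \<in> K" using complex_down[OF S(1)] by blast
      have PS: "P \<union> (S - P) = S" using S(2) by blast
      have "\<rho> = Cone P + Cone (S - P)" unfolding S(3) Cone_Un[symmetric] PS ..
      moreover have "Cone P + Cone (S - P) \<in> \<Sigma>" using join[OF T] S(1) PS by simp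
      moreover have "Cone P \<inter> Cone (S - P) = {0}" using disj[OF T] by blast
      ultimately show "\<rho> \<in> ?A" using complex_Cone[OF T] by blast
    qed
  qed
  have kept: "\<Sigma> - ?A = Cone ` {S \<in> K. \<not> P \<subseteq> S}"
  proof -
    have "inj_on Cone K" using Cone_eq_iff by (intro inj_onI) blast
    then have "Cone ` (K - {S \<in> K. P \<subseteq> S}) = Cone ` K - Cone ` {S \<in> K. P \<subseteq> S}"
      by (rule inj_on_image_set_diff) auto
    moreover have "K - {S \<in> K. P \<subseteq> S} = {S \<in> K. \<not> P \<subseteq> S}" by blast
    ultimately show ?thesis unfolding removed fan_eq_image[symmetric] by simp
  qed
  have new_face: "cone_face \<rho> (Cone (P - {y} \<union> {?x}) + Cone T) \<longleftrightarrow>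
      (\<exists>A \<subseteq> insert ?x (P \<union> T - {y}). \<rho> = Cone A)"
    if "y \<in> P" "P \<inter> T = {}" "P \<union> T \<in> K" for \<rho> y T
  proof -
    have "y \<notin> T" using that by blast
    then have bp: "basis_part N (insert ?x (P \<union> T - {y}))"
      using basis_part_barycentre[of N T P y] complex_basis_part[OF that(3)] that(1)
      by (simp add: Un_commute)
    have "P - {y} \<union> {?x} \<union> T = insert ?x (P \<union> T - {y})" using \<open>y \<notin> T\<close> by blast
    then show ?thesis
      unfolding Cone_Un[symmetric] using cone_face_simplicial_iff[OF basis_part_independent[OF bp]]
      by simp
  qed
  let ?C = "{\<rho>. \<exists>\<tau>\<in>\<Sigma>. \<exists>y\<in>P. Cone P \<inter> \<tau> = {0} \<and> Cone P + \<tau> \<in> \<Sigma> \<and>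
        cone_face \<rho> (Cone ((P - {y}) \<union> {?x}) + \<tau>)}"
  have new: "\<rho> \<in> ?C \<longleftrightarrow> (\<exists>y T A. T \<in> K \<and> y \<in> P \<and> P \<inter> T = {} \<and> P \<union> T \<in> K \<and>
      A \<subseteq> insert ?x (P \<union> T - {y}) \<and> \<rho> = Cone A)" (is "_ \<longleftrightarrow> ?R") for \<rho>
  proof
    assume "\<rho> \<in> ?C"
    then obtain \<tau> y where \<tau>: "\<tau> \<in> \<Sigma>" "y \<in> P" "Cone P \<inter> \<tau> = {0}" "Cone P + \<tau> \<in> \<Sigma>"
      "cone_face \<rho> (Cone ((P - {y}) \<union> {?x}) + \<tau>)" by blast
    obtain T where T: "T \<in> K" "\<tau> = Cone T" using cone_generated[OF \<tau>(1)] .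
    have PT: "P \<inter> T = {}" "P \<union> T \<in> K"
      using disj[OF T(1)] join[OF T(1)] \<tau>(3,4) T(2) by auto
    then obtain A where "A \<subseteq> insert ?x (P \<union> T - {y})" "\<rho> = Cone A"
      using new_face[OF \<tau>(2) PT] \<tau>(5) T(2) by auto
    then show ?R using T(1) \<tau>(2) PT by blast
  next
    assume ?R
    then obtain y T A where T: "T \<in> K" "y \<in> P" "P \<inter> T = {}" "P \<union> T \<in> K"
      and A: "A \<subseteq> insert ?x (P \<union> T - {y})" "\<rho> = Cone A" by blast
    have "cone_face \<rho> (Cone ((P - {y}) \<union> {?x}) + Cone T)"
      using new_face[OF T(2-4)] A by blast
    moreover have "Cone P \<inter> Cone T = {0}" "Cone P + Cone T \<in> \<Sigma>"
      using disj[OF T(1)] join[OF T(1)] T(3,4) by blast+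
    ultimately show "\<rho> \<in> ?C" using complex_Cone[OF T(1)] T(2) by blast
  qed
  have "Cone ` {S \<in> K. \<not> P \<subseteq> S} \<union> ?C = Cone ` star_complex K P"
  proof
    show "Cone ` {S \<in> K. \<not> P \<subseteq> S} \<union> ?C \<subseteq> Cone ` star_complex K P"
    proof
      fix \<rho> assume "\<rho> \<in> Cone ` {S \<in> K. \<not> P \<subseteq> S} \<union> ?C"
      then consider "\<rho> \<in> Cone ` {S \<in> K. \<not> P \<subseteq> S}" | "\<rho> \<in> ?C" by blast
      then show "\<rho> \<in> Cone ` star_complex K P"
      proof cases
        case 1
        then show ?thesis unfolding star_complex_def by blast
      next
        case 2
        then obtain y T A where T: "T \<in> K" "y \<in> P" "P \<inter> T = {}" "P \<union> T \<in> K"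
          and A: "A \<subseteq> insert ?x (P \<union> T - {y})" "\<rho> = Cone A"
          unfolding new by blast
        have sub: "A - {?x} \<subseteq> P \<union> T - {y}" using A(1) by blast
        then have A0: "A - {?x} \<in> K" "\<not> P \<subseteq> A - {?x}"
          using complex_down[OF T(4)] T(2) by blast+
        have "A - {?x} \<union> P \<in> K"
          by (rule complex_down[OF T(4)]) (use sub in blast)
        then have "insert ?x (A - {?x}) \<in> star_complex K P"
          using A0 unfolding star_complex_def by blast
        moreover have "A - {?x} \<in> star_complex K P"
          using A0 unfolding star_complex_def by blast
        ultimately have "A \<in> star_complex K P"
          by (cases "?x \<in> A") (simp_all add: insert_absorb)
        then show ?thesis using A(2) by blast
      qed
    qed
    show "Cone ` star_complex K P \<subseteq> Cone ` {S \<in> K. \<not> P \<subseteq> S} \<union> ?C"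
    proof
      fix \<rho> assume "\<rho> \<in> Cone ` star_complex K P"
      then consider "\<rho> \<in> Cone ` {S \<in> K. \<not> P \<subseteq> S}"
        | S where "\<rho> = Cone (insert ?x S)" "S \<in> K" "\<not> P \<subseteq> S" "S \<union> P \<in> K"
        unfolding star_complex_def by blast
      then show "\<rho> \<in> Cone ` {S \<in> K. \<not> P \<subseteq> S} \<union> ?C"
      proof cases
        case 2
        obtain y where y: "y \<in> P" "y \<notin> S" using 2(3) by blast
        have "S - P \<in> K" using complex_down[OF 2(2)] by blast
        moreover have "P \<union> (S - P) \<in> K" using 2(4) by (simp add: Un_commute)
        moreover have "insert ?x S \<subseteq> insert ?x (P \<union> (S - P) - {y})" using y by blast
        ultimately have "\<rho> \<in> ?C" unfolding new using y(1) 2(1) by blast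
        then show ?thesis by blast
      qed blast
    qed
  qed
  then show ?thesis
    unfolding star_subdivision_def cone_gens_complex[OF P] kept by simp
qed

lemma fan_gens_ray: "x \<in> fan_gens N \<Sigma> \<longleftrightarrow> {x} \<in> K"
proof
  assume "x \<in> fan_gens N \<Sigma>"
  then show "{x} \<in> K" unfolding cone_complex_def fan_gens_def by auto
qed (use complex_gens in blast)

lemma gen_in_Cone_iff:
  assumes "x \<in> fan_gens N \<Sigma>" "S \<in> K"
  shows "x \<in> Cone S \<longleftrightarrow> x \<in> S"
  using cone_gens_complex[OF assms(2)] assms(1) unfolding cone_gens_def by blast

lemma PC_iff:
  "P \<in> PC N \<Sigma> \<longleftrightarrow> P \<noteq> {} \<and> P \<subseteq> fan_gens N \<Sigma> \<and> P \<notin> K \<and> (\<forall>y\<in>P. P - {y} \<in> K)"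
  unfolding PC_def primitive_collection_def cone_complex_def by blast

lemma PC_finite: "P \<in> PC N \<Sigma> \<Longrightarrow> finite P"
  unfolding PC_iff using complex_finite by (metis all_not_in_conv finite_Diff2 finite.emptyI finite_insert)

text \<open>
  Primitive collections are the minimal nonfaces of the complex.
\<close>
lemma contains_PC:
  assumes "finite A" "A \<subseteq> fan_gens N \<Sigma>" "A \<notin> K"
  shows "\<exists>Q\<in>PC N \<Sigma>. Q \<subseteq> A"
  using assms
proof (induction A rule: finite_psubset_induct)
  case (psubset A)
  show ?case
  proof (cases "\<forall>y\<in>A. A - {y} \<in> K")
    case True
    have "A \<noteq> {}" using psubset.prems(2) complex_empty by auto
    then have "A \<in> PC N \<Sigma>" unfolding PC_iff using True psubset.prems by blast
    then show ?thesis by blast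
  next
    case False
    then obtain y where y: "y \<in> A" "A - {y} \<notin> K" by blast
    then have "A - {y} \<subset> A" "A - {y} \<subseteq> fan_gens N \<Sigma>" using psubset.prems by blast+
    then obtain Q where "Q \<in> PC N \<Sigma>" "Q \<subseteq> A - {y}"
      using psubset.IH y(2) by blast
    then show ?thesis by blast
  qed
qed

text \<open>
  The combinatorial content of the condition on cones in the second statement of the theorem.
\<close>
definition absorbs :: "'a set \<Rightarrow> 'a \<Rightarrow> bool" where
  "absorbs P x \<longleftrightarrow> (\<forall>S\<in>K. x \<in> S \<longrightarrow> (\<forall>y\<in>P. S \<union> P - {y} \<in> K))"

lemma absorbs_iff_cones:
  assumes P: "P \<subseteq> fan_gens N \<Sigma>" and x: "x \<in> fan_gens N \<Sigma>"
  shows "(\<forall>\<sigma>\<in>\<Sigma>. x \<in> \<sigma> \<longrightarrow>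
             (\<forall>y\<in>P. scrp_cone N (Cone ((cone_gens N \<Sigma> \<sigma> \<union> P) - {y})) \<and>
                    Cone ((cone_gens N \<Sigma> \<sigma> \<union> P) - {y}) \<in> \<Sigma>)) \<longleftrightarrow> absorbs P x"
    (is "?L \<longleftrightarrow> _")
proof
  assume L: ?L
  have "S \<union> P - {y} \<in> K" if S: "S \<in> K" "x \<in> S" "y \<in> P" for S y
  proof -
    have "Cone (S \<union> P - {y}) \<in> \<Sigma>"
      using L complex_Cone[OF S(1)] in_Cone[OF S(2)] S(3) cone_gens_complex[OF S(1)] by auto
    then show ?thesis
      using complex_iff[of "S \<union> P - {y}"] complex_gens[OF S(1)] P by blast
  qed
  then show "absorbs P x" unfolding absorbs_def by blast
next
  assume R: "absorbs P x"
  show ?L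
  proof (intro ballI impI)
    fix \<sigma> y assume \<sigma>: "\<sigma> \<in> \<Sigma>" "x \<in> \<sigma>" and y: "y \<in> P"
    obtain S where S: "S \<in> K" "\<sigma> = Cone S" using cone_generated[OF \<sigma>(1)] .
    have "x \<in> S" using gen_in_Cone_iff[OF x S(1)] \<sigma>(2) S(2) by simp
    then have "Cone (S \<union> P - {y}) \<in> \<Sigma>"
      using R S(1) y complex_Cone unfolding absorbs_def by blast
    moreover have "\<forall>\<sigma>\<in>\<Sigma>. scrp_cone N \<sigma>" using fan unfolding fan_def by blast
    ultimately show "scrp_cone N (Cone ((cone_gens N \<Sigma> \<sigma> \<union> P) - {y})) \<and>
                    Cone ((cone_gens N \<Sigma> \<sigma> \<union> P) - {y}) \<in> \<Sigma>"
      unfolding S(2) cone_gens_complex[OF S(1)] by blast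
  qed
qed

text \<open>
  If \<open>P'\<close> violated the right-hand side, \<open>(P' - P) \<union> {x}\<close> would be a face, and enlarging it by all of
  \<open>P\<close> except one vector outside \<open>P'\<close> would give a face that contains \<open>P'\<close>. Conversely, if
  \<open>S \<union> P - {y}\<close> is a nonface, it contains a primitive collection \<open>P'\<close>, which meets \<open>P\<close> and differs
  from it, and the primitive collection inside \<open>(P' - P) \<union> {x}\<close> would be contained in the face \<open>S\<close>.
\<close>
lemma absorbs_iff_PC:
  assumes P: "P \<in> PC N \<Sigma>" and x: "x \<in> fan_gens N \<Sigma>"
  shows "absorbs P x \<longleftrightarrow> (\<forall>P'\<in>PC N \<Sigma>. P \<inter> P' \<noteq> {} \<and> P \<noteq> P' \<longrightarrow>
             (\<exists>Q\<in>PC N \<Sigma>. Q \<subseteq> (P' - P) \<union> {x}))" (is "_ \<longleftrightarrow> ?R")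
proof
  assume abs: "absorbs P x"
  show ?R
  proof (intro ballI impI)
    fix P' assume P': "P' \<in> PC N \<Sigma>" "P \<inter> P' \<noteq> {} \<and> P \<noteq> P'"
    have "P' - P \<union> {x} \<notin> K"
    proof
      assume K: "P' - P \<union> {x} \<in> K"
      have "\<not> P \<subseteq> P'"
      proof
        assume PP': "P \<subseteq> P'"
        then obtain z where "z \<in> P'" "P \<subseteq> P' - {z}" using P'(2) by blast
        then show False using P P'(1) complex_down unfolding PC_iff by blast
      qed
      then obtain y where y: "y \<in> P" "y \<notin> P'" by blast
      then have "P' - P \<union> {x} \<union> P - {y} \<in> K"
        using abs K unfolding absorbs_def by blast
      then have "P' \<in> K" by (rule complex_down) (use y in blast)
      then show False using P'(1) unfolding PC_iff by blast
    qed
    moreover have "finite (P' - P \<union> {x})" using PC_finite[OF P'(1)] by simp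
    moreover have "P' - P \<union> {x} \<subseteq> fan_gens N \<Sigma>" using P'(1) x unfolding PC_iff by blast
    ultimately show "\<exists>Q\<in>PC N \<Sigma>. Q \<subseteq> (P' - P) \<union> {x}"
      using contains_PC[of "P' - P \<union> {x}"] by blast
  qed
next
  assume R: ?R
  show "absorbs P x"
    unfolding absorbs_def
  proof (intro ballI impI, rule ccontr)
    fix S y assume S: "S \<in> K" "x \<in> S" and y: "y \<in> P" and nK: "S \<union> P - {y} \<notin> K"
    have "finite (S \<union> P - {y})" using complex_finite[OF S(1)] PC_finite[OF P] by simp
    moreover have "S \<union> P - {y} \<subseteq> fan_gens N \<Sigma>"
      using complex_gens[OF S(1)] P unfolding PC_iff by blast
    ultimately obtain P' where P': "P' \<in> PC N \<Sigma>" "P' \<subseteq> S \<union> P - {y}"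
      using contains_PC nK by blast
    have PCD: "Q \<in> PC N \<Sigma> \<Longrightarrow> \<not> Q \<subseteq> S" for Q
      using complex_down[OF S(1)] unfolding PC_iff by blast
    have "P \<inter> P' \<noteq> {} \<and> P \<noteq> P'" using PCD[OF P'(1)] P'(2) y by blast
    then obtain Q where "Q \<in> PC N \<Sigma>" "Q \<subseteq> (P' - P) \<union> {x}"
      using R P'(1) by blast
    then show False using PCD[of Q] P'(2) S(2) by blast
  qed
qed

text \<open>
  A cone with \<open>x\<close> in its relative interior is contained in each of its faces through \<open>x\<close>, so it is
  the ray of \<open>x\<close>.
\<close>
lemma primitive_cone_ray:
  assumes x: "{x} \<in> K" and P: "\<Sum>P = x"
  shows "primitive_cone \<Sigma> P = Cone {x}"
  unfolding primitive_cone_def P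
proof (rule the_equality)
  have ray: "v \<in> Cone {x} \<longleftrightarrow> (\<exists>t\<ge>0. v = t *\<^sub>R x)" for v
  proof
    assume "v \<in> Cone {x}"
    then obtain c where "v = c x *\<^sub>R x" "0 \<le> c x" by (auto simp: Cone_finite)
    then show "\<exists>t\<ge>0. v = t *\<^sub>R x" by blast
  next
    assume "\<exists>t\<ge>0. v = t *\<^sub>R x"
    then show "v \<in> Cone {x}" using convex_cone_hull_mul[OF in_Cone[of x "{x}"]] by auto
  qed
  have "\<exists>e>1. (1 - e) *\<^sub>R v + e *\<^sub>R x \<in> Cone {x}" if v: "v \<in> Cone {x}" for v
  proof -
    obtain t where t: "0 \<le> t" "v = t *\<^sub>R x" using v unfolding ray by blast
    \<comment> \<open>The segment from \<open>v\<close> through \<open>x\<close> is prolonged beyond \<open>x\<close>, up to the apex if it heads there.\<close>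
    define e where "e = (if t \<le> 1 then 2 else t / (t - 1))"
    have "1 < e" "0 \<le> (1 - e) * t + e"
      using t(1) by (auto simp: e_def field_simps)
    moreover have "(1 - e) *\<^sub>R v + e *\<^sub>R x = ((1 - e) * t + e) *\<^sub>R x"
      unfolding t(2) by (simp add: scaleR_left_distrib)
    ultimately show ?thesis unfolding ray by metis
  qed
  then have "x \<in> rel_interior (Cone {x})"
    using convex_rel_interior_iff[OF convex_convex_cone_hull convex_cone_hull_nonempty] by blast
  then show "Cone {x} \<in> \<Sigma> \<and> x \<in> rel_interior (Cone {x})"
    using complex_Cone[OF x] by blast
next
  fix \<tau> assume \<tau>: "\<tau> \<in> \<Sigma> \<and> x \<in> rel_interior \<tau>"
  then obtain T where T: "T \<in> K" "\<tau> = Cone T" using cone_generated by blast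
  have xT: "x \<in> Cone T" using \<tau> T(2) rel_interior_subset by blast
  then have "x \<in> T" using gen_in_Cone_iff[OF _ T(1)] x fan_gens_ray by blast
  then have sub: "{x} \<subseteq> T" by blast
  have "Cone {x} face_of Cone T"
    using complex_face[OF T(1)] sub unfolding cone_face_def by blast
  moreover have "Cone {x} \<inter> rel_interior (Cone T) \<noteq> {}"
    using \<tau> T(2) in_Cone[of x "{x}"] by blast
  ultimately have "Cone T \<subseteq> Cone {x}" by (rule subset_of_face_of[OF _ order_refl])
  then show "\<tau> = Cone {x}" using Cone_mono[OF sub] T(2) by blast
qed

end

section \<open>Blow-ups satisfy the combinatorial condition\<close>

text \<open>
  After the subdivision \<open>P\<close> is a nonface, while its proper subsets survive. A new cone through \<open>\<Sum>P\<close>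
  is generated by \<open>\<Sum>P\<close> and a set \<open>T\<close> such that \<open>T \<union> P\<close> is an old face; hence \<open>T\<close> may be enlarged by
  any proper subset of \<open>P\<close>.
\<close>
lemma star_subdivision_primitive:
  assumes \<Sigma>': "smooth_fan N \<Sigma>'" and \<Sigma>: "smooth_fan N \<Sigma>"
    and P: "P \<in> cone_complex N \<Sigma>'" and card: "2 \<le> card P"
    and star: "\<Sigma> = star_subdivision N \<Sigma>' (Cone P)"
  shows "P \<in> PC N \<Sigma>" "\<Sum>P \<in> fan_gens N \<Sigma>" "primitive_relation N \<Sigma> P {\<Sum>P} (\<lambda>_. 1)"
    "smooth_fan.absorbs N \<Sigma> P (\<Sum>P)"
proof -
  interpret A: smooth_fan N \<Sigma>' by (rule \<Sigma>')
  interpret B: smooth_fan N \<Sigma> by (rule \<Sigma>)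
  let ?x = "\<Sum>P"
  have K: "B.K = star_complex A.K P"
    by (rule B.complex_eqI[OF A.star_complex_basis_part], assumption)
      (rule star[unfolded A.star_subdivision_eq[OF P]])
  have small: "\<not> P \<subseteq> {p}" for p
    using card card_mono[of "{p}" P] by auto
  have x: "{?x} \<in> B.K"
    unfolding K star_complex_def using A.complex_empty P card by auto
  show xG: "?x \<in> fan_gens N \<Sigma>" using x B.fan_gens_ray by blast
  have kept: "S \<in> B.K" if "S \<in> A.K" "\<not> P \<subseteq> S" for S
    unfolding K star_complex_def using that by blast
  have xP: "?x \<notin> P"
  proof
    assume "?x \<in> P"
    then have "{?x} \<in> A.K" using A.complex_down[OF P] by blast
    then show False
      using A.barycentre_in_Cone[OF P] in_Cone[of ?x "{?x}"] small by blast
  qed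
  have "P \<noteq> {}" using card by auto
  moreover have "P \<subseteq> fan_gens N \<Sigma>"
  proof
    fix p assume "p \<in> P"
    then have "{p} \<in> A.K" using A.complex_down[OF P] by blast
    then show "p \<in> fan_gens N \<Sigma>" using kept small B.fan_gens_ray by blast
  qed
  moreover have "P \<notin> B.K"
    unfolding K star_complex_def using xP by blast
  moreover have "P - {y} \<in> B.K" if "y \<in> P" for y
    using kept A.complex_down[OF P, of "P - {y}"] that by blast
  ultimately show "P \<in> PC N \<Sigma>" unfolding B.PC_iff by blast
  show "primitive_relation N \<Sigma> P {?x} (\<lambda>_. 1)"
    unfolding primitive_relation_def B.primitive_cone_ray[OF x refl] B.cone_gens_complex[OF x]
    by simp
  show "B.absorbs P ?x"
    unfolding B.absorbs_def
  proof (intro ballI impI)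
    fix S y assume S: "S \<in> B.K" "?x \<in> S" and y: "y \<in> P"
    have old: "\<not> (S \<in> A.K \<and> \<not> P \<subseteq> S)"
      using A.barycentre_in_Cone[OF P] in_Cone[OF S(2)] by blast
    have "S \<in> A.K \<and> \<not> P \<subseteq> S
        \<or> (\<exists>T. S = insert ?x T \<and> T \<in> A.K \<and> \<not> P \<subseteq> T \<and> T \<union> P \<in> A.K)"
      using S(1) unfolding K star_complex_def by simp
    then have "\<exists>T. S = insert ?x T \<and> T \<in> A.K \<and> \<not> P \<subseteq> T \<and> T \<union> P \<in> A.K"
      by (rule disjE) (rule notE[OF old])
    then obtain T where T: "S = insert ?x T" "T \<in> A.K" "T \<union> P \<in> A.K" by (elim exE conjE)
    let ?U = "T \<union> P - {y}"
    have "?U \<in> A.K" by (rule A.complex_down[OF T(3)]) (rule Diff_subset)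
    moreover have "\<not> P \<subseteq> ?U" using y by blast
    moreover have "?U \<union> P \<in> A.K"
      by (rule A.complex_down[OF T(3)]) (use y in blast)
    ultimately have "?U \<in> A.K \<and> \<not> P \<subseteq> ?U \<and> ?U \<union> P \<in> A.K" by (intro conjI)
    then have "\<exists>V. insert ?x ?U = insert ?x V \<and> V \<in> A.K \<and> \<not> P \<subseteq> V \<and> V \<union> P \<in> A.K"
      by (intro exI[of _ ?U] conjI refl) (elim conjE, assumption)+
    then have "insert ?x ?U \<in> B.K"
      unfolding K star_complex_def by (intro UnI2 CollectI)
    moreover have "S \<union> P - {y} = insert ?x ?U" using T(1) xP y by blast
    ultimately show "S \<union> P - {y} \<in> B.K" by simp
  qed
qed

section \<open>Blowing down\<close>

text \<open>
  The star of \<open>x\<close> is replaced by faces through \<open>P\<close>. If \<open>P\<close> is a primitive collection with sum \<open>x\<close> and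
  the absorption property holds, this inverts the stellar subdivision at \<open>P\<close>; see \<open>star_down\<close>.
\<close>
definition blow_down :: "'a::euclidean_space set set \<Rightarrow> 'a set \<Rightarrow> 'a \<Rightarrow> 'a set set" where
  "blow_down K P x = {S \<in> K. x \<notin> S} \<union> {S - {x} \<union> P | S. S \<in> K \<and> x \<in> S}"

locale contractible = smooth_fan +
  fixes P x
  assumes P: "P \<in> PC N \<Sigma>" and xG: "x \<in> fan_gens N \<Sigma>" and sum: "\<Sum>P = x" and absorbs: "absorbs P x"
begin

abbreviation "L \<equiv> blow_down K P x"

lemma P_facts: "P \<noteq> {}" "P \<subseteq> fan_gens N \<Sigma>" "P \<notin> K" "y \<in> P \<Longrightarrow> P - {y} \<in> K" "finite P"
  using P PC_finite[OF P] unfolding PC_iff by blast+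

lemma x_ray: "{x} \<in> K"
  using xG fan_gens_ray by blast

lemma absorb: "S \<in> K \<Longrightarrow> x \<in> S \<Longrightarrow> y \<in> P \<Longrightarrow> S \<union> P - {y} \<in> K"
  using absorbs unfolding absorbs_def by blast

text \<open>
  Otherwise the vectors of \<open>P - {x}\<close>, which are independent, would have sum 0, which leaves \<open>P = {x}\<close>.
\<close>
lemma x_notin: "x \<notin> P"
proof
  assume xP: "x \<in> P"
  have "\<Sum>P = x + \<Sum>(P - {x})" by (rule sum.remove[OF P_facts(5) xP])
  then have "(\<Sum>p\<in>P - {x}. 1 *\<^sub>R p) = (\<Sum>p\<in>P - {x}. 0 *\<^sub>R p)"
    using sum by simp
  then have "(1::real) = 0" if "p \<in> P - {x}" for p
    by (rule independent_coeffs_eq[OF complex_independent[OF P_facts(4)[OF xP]] _ that])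
  then have "P - {x} = {}" by (intro equals0I) simp
  then have "P = {x}" using xP by blast
  then show False using P_facts(3) x_ray by simp
qed

lemma card_P: "2 \<le> card P"
proof (rule ccontr)
  assume "\<not> 2 \<le> card P"
  moreover have "card P \<noteq> 0" using P_facts(1,5) by simp
  ultimately have "card P = 1" by linarith
  then obtain p where "P = {p}" by (auto simp: card_1_singleton_iff)
  then show False using sum x_notin by auto
qed

lemma down_x_notin: "S \<in> L \<Longrightarrow> x \<notin> S"
  unfolding blow_down_def using x_notin by blast

lemma nonface: "S \<in> K \<Longrightarrow> \<not> P \<subseteq> S"
  using complex_down P_facts(3) by blast

lemma down_cases:
  assumes "S \<in> L"
  obtains "S \<in> K" "x \<notin> S" | T where "S = T - {x} \<union> P" "T \<in> K" "x \<in> T"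
  using assms unfolding blow_down_def by blast

lemma down_K: "S \<in> L \<Longrightarrow> \<not> P \<subseteq> S \<Longrightarrow> S \<in> K"
  unfolding blow_down_def by blast

lemma down_empty: "{} \<in> L"
  unfolding blow_down_def using complex_empty by blast

lemma P_down: "P \<in> L"
  unfolding blow_down_def using x_ray by fastforce

lemma down_subset:
  assumes S: "S \<in> L" and "A \<subseteq> S"
  shows "A \<in> L"
  using S
proof (cases rule: down_cases)
  case 1
  then show ?thesis unfolding blow_down_def using complex_down[OF 1(1)] assms(2) by blast
next
  case (2 T)
  show ?thesis
  proof (cases "P \<subseteq> A")
    case True
    have "insert x (A - P) \<in> K"
      by (rule complex_down[OF 2(2)]) (use 2 assms(2) in blast)
    moreover have "A = insert x (A - P) - {x} \<union> P"
      using True assms(2) 2(1) x_notin by blast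
    ultimately show ?thesis unfolding blow_down_def by blast
  next
    case False
    then obtain y where y: "y \<in> P" "y \<notin> A" by blast
    have "A \<in> K"
      by (rule complex_down[OF absorb[OF 2(2,3) y(1)]]) (use 2 assms(2) y in blast)
    moreover have "x \<notin> A" using assms(2) down_x_notin[OF S] by blast
    ultimately show ?thesis unfolding blow_down_def by blast
  qed
qed

lemma down_basis_part:
  assumes "S \<in> L"
  shows "basis_part N S"
  using assms
proof (cases rule: down_cases)
  case 1
  then show ?thesis using complex_basis_part by blast
next
  case (2 T)
  \<comment> \<open>The omitted vector \<open>y\<close> must lie outside \<open>T\<close>; otherwise \<open>T \<union> P - {y}\<close> would lose a member of \<open>T\<close>.\<close>
  obtain y where y: "y \<in> P" "y \<notin> T" using nonface[OF 2(2)] by blast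
  have "insert (\<Sum>P) (T - {x} \<union> (P - {y})) = T \<union> P - {y}"
    using sum 2(3) y x_notin by blast
  then have "basis_part N (insert (\<Sum>P) (T - {x} \<union> (P - {y})))"
    using complex_basis_part[OF absorb[OF 2(2,3) y(1)]] by simp
  then show ?thesis
    unfolding 2(1) by (rule basis_part_unbarycentre) (use y sum x_notin P_facts in auto)
qed

text \<open>
  Coordinates for the blown-down complex are turned into coordinates for \<open>K\<close> by means of
  \<open>\<Sum>P = x\<close>: the largest possible multiple of \<open>\<Sum>P\<close> is taken out and booked as a coordinate at \<open>x\<close>.
  At least one coordinate on \<open>P\<close> then vanishes. The operation can be undone, since the multiple is
  visible as the coordinate at \<open>x\<close>.
\<close>
definition transfer :: "('a \<Rightarrow> real) \<Rightarrow> 'a \<Rightarrow> real" where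
  "transfer c s = c s - (if s \<in> P then Min (c ` P) else 0) + (if s = x then Min (c ` P) else 0)"

lemma comb_transfer:
  assumes c: "c \<in> coords L"
  shows "comb (transfer c) = comb c"
proof -
  let ?m = "Min (c ` P)"
  have "{s. c s \<noteq> 0} \<in> L" using c unfolding coords_def by blast
  then have fin: "finite {s. c s \<noteq> 0}" using basis_part_finite[OF down_basis_part] by blast
  let ?A = "insert x ({s. c s \<noteq> 0} \<union> P)"
  have A: "finite ?A" using fin P_facts(5) by simp
  have P_sum: "(\<Sum>s\<in>?A. (if s \<in> P then ?m else 0) *\<^sub>R s) = ?m *\<^sub>R x"
  proof -
    have "(\<Sum>s\<in>?A. (if s \<in> P then ?m else 0) *\<^sub>R s) = (\<Sum>s\<in>P. ?m *\<^sub>R s)"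
      by (rule sum.mono_neutral_cong_right[OF A]) auto
    then show ?thesis using sum by (simp add: scaleR_sum_right[symmetric])
  qed
  have x_sum: "(\<Sum>s\<in>?A. (if s = x then ?m else 0) *\<^sub>R s) = ?m *\<^sub>R x"
    by (rule sum_single[OF A]) blast
  have "comb (transfer c) = (\<Sum>s\<in>?A. transfer c s *\<^sub>R s)"
    by (rule comb_eq_sum[OF A]) (auto simp: transfer_def split: if_splits)
  also have "\<dots> = (\<Sum>s\<in>?A. c s *\<^sub>R s) - (\<Sum>s\<in>?A. (if s \<in> P then ?m else 0) *\<^sub>R s)
      + (\<Sum>s\<in>?A. (if s = x then ?m else 0) *\<^sub>R s)"
    unfolding transfer_def scaleR_left_distrib scaleR_left_diff_distrib sum.distrib sum_subtractf ..
  also have "\<dots> = (\<Sum>s\<in>?A. c s *\<^sub>R s)" unfolding P_sum x_sum by simp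
  also have "\<dots> = comb c"
    by (rule comb_eq_sum[OF A, symmetric]) blast
  finally show ?thesis .
qed

text \<open>
  If the minimum on \<open>P\<close> is 0, the support is an old face and nothing changes. Otherwise the support is
  \<open>(T - {x}) \<union> P\<close> for a face \<open>T\<close> through \<open>x\<close>, and the new support avoids the place \<open>y\<close> of the
  minimum, so it lies in the face \<open>T \<union> P - {y}\<close> provided by the absorption property.
\<close>
lemma transfer_coords:
  assumes c: "c \<in> coords L"
  shows "transfer c \<in> coords K"
proof -
  let ?m = "Min (c ` P)" and ?S = "{s. c s \<noteq> 0}"
  have S: "?S \<in> L" and pos: "\<And>s. 0 \<le> c s" using c unfolding coords_def by auto
  have le: "?m \<le> c p" if "p \<in> P" for p using P_facts(5) that by simp
  have "?m \<in> c ` P" using P_facts(1,5) by (intro Min_in) auto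
  then obtain y where y: "y \<in> P" "c y = ?m" by auto
  have m: "0 \<le> ?m" using pos[of y] y(2) by simp
  have nonneg: "0 \<le> transfer c s" for s
    unfolding transfer_def using le[of s] pos[of s] m by simp
  have yx: "y \<noteq> x" using y(1) x_notin by blast
  have "{s. transfer c s \<noteq> 0} \<in> K"
  proof (cases "?m = 0")
    case True
    then have "{s. transfer c s \<noteq> 0} = ?S" unfolding transfer_def by auto
    moreover have "\<not> P \<subseteq> ?S" using y True by auto
    ultimately show ?thesis using down_K[OF S] by simp
  next
    case False
    then have "c p \<noteq> 0" if "p \<in> P" for p using le[OF that] m by simp
    then have "P \<subseteq> ?S" by blast
    then obtain T where T: "?S = T - {x} \<union> P" "T \<in> K" "x \<in> T"
      using down_cases[OF S] nonface by metis
    have "s \<in> T \<union> P - {y}" if "transfer c s \<noteq> 0" for s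
    proof -
      have "s \<noteq> y" using that y yx unfolding transfer_def by auto
      moreover have "s \<in> ?S \<or> s = x \<or> s \<in> P"
        using that unfolding transfer_def by (auto split: if_splits)
      ultimately show ?thesis using T(1,3) by blast
    qed
    then show ?thesis
      by (intro complex_down[OF absorb[OF T(2,3) y(1)]]) blast
  qed
  then show ?thesis unfolding coords_def using nonneg by blast
qed

lemma down_inj: "inj_on comb (coords L)"
proof
  fix c d assume c: "c \<in> coords L" and d: "d \<in> coords L" and eq: "comb c = comb d"
  have "comb (transfer c) = comb (transfer d)"
    using eq comb_transfer[OF c] comb_transfer[OF d] by simp
  then have t: "transfer c = transfer d"
    by (rule inj_onD[OF inj_comb _ transfer_coords[OF c] transfer_coords[OF d]])
  have x0: "e x = 0" if "e \<in> coords L" for e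
    using that down_x_notin[of "{s. e s \<noteq> 0}"] unfolding coords_def by blast
  have m: "transfer e x = Min (e ` P)" if "e \<in> coords L" for e
    unfolding transfer_def using x0[OF that] x_notin by simp
  have mm: "Min (c ` P) = Min (d ` P)" using m[OF c] m[OF d] t by simp
  show "c = d"
  proof
    fix s show "c s = d s"
      using fun_cong[OF t, of s] unfolding transfer_def mm by simp
  qed
qed

lemma down_smooth: "smooth_fan N (Cone ` L)"
  by (rule smooth_fan_of_complex[OF down_empty down_subset down_basis_part down_inj])

lemma down_complex: "cone_complex N (Cone ` L) = L"
  by (rule smooth_fan.complex_eqI[OF down_smooth down_basis_part refl])

lemma down_finite:
  assumes "finite \<Sigma>"
  shows "finite (Cone ` L)"
proof -
  have "inj_on Cone K" using Cone_eq_iff by (intro inj_onI) blast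
  then have "finite K" using assms fan_eq_image finite_imageD by metis
  moreover have "L \<subseteq> K \<union> (\<lambda>S. S - {x} \<union> P) ` K" unfolding blow_down_def by blast
  ultimately have "finite L" using finite_subset by blast
  then show ?thesis by simp
qed

lemma down_complete:
  assumes "complete_fan N \<Sigma>"
  shows "complete_fan N (Cone ` L)"
proof -
  have below: "Cone S \<subseteq> span N" if "S \<in> L" for S
    using Cone_subset_span[of S] span_mono[OF basis_part_lattice[OF down_basis_part[OF that]]] by blast
  have above: "\<exists>T\<in>L. Cone S \<subseteq> Cone T" if S: "S \<in> K" for S
  proof (cases "x \<in> S")
    case True
    let ?T = "S - {x} \<union> P"
    have "x \<in> Cone P" using sum_in_Cone[of P "\<lambda>_. 1"] sum by simp
    then have "x \<in> Cone ?T" using Cone_mono[of P ?T] by blast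
    then have "S \<subseteq> Cone ?T" using in_Cone[of _ ?T] by blast
    then have "Cone S \<subseteq> Cone ?T"
      by (rule hull_minimal) (rule convex_cone_convex_cone_hull)
    moreover have "?T \<in> L" unfolding blow_down_def using S True by blast
    ultimately show ?thesis by blast
  next
    case False
    then have "S \<in> L" unfolding blow_down_def using S by blast
    then show ?thesis by blast
  qed
  have "span N \<subseteq> \<Union> (Cone ` L)"
  proof
    fix v assume "v \<in> span N"
    then obtain \<sigma> where \<sigma>: "\<sigma> \<in> \<Sigma>" "v \<in> \<sigma>"
      using assms unfolding complete_fan_def by blast
    obtain S where S: "S \<in> K" "\<sigma> = Cone S" using cone_generated[OF \<sigma>(1)] .
    then show "v \<in> \<Union> (Cone ` L)" using above[OF S(1)] \<sigma>(2) by blast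
  qed
  moreover have "\<Union> (Cone ` L) \<subseteq> span N"
    by (rule Union_least) (use below in blast)
  ultimately show ?thesis unfolding complete_fan_def by (intro subset_antisym)
qed

lemma star_down: "star_complex L P = K"
proof
  show "star_complex L P \<subseteq> K"
  proof
    fix S assume "S \<in> star_complex L P"
    then consider "S \<in> L" "\<not> P \<subseteq> S"
      | T where "S = insert x T" "T \<in> L" "\<not> P \<subseteq> T" "T \<union> P \<in> L"
      unfolding star_complex_def sum by blast
    then show "S \<in> K"
    proof cases
      case 1
      then show ?thesis using down_K by blast
    next
      case 2
      obtain y where y: "y \<in> P" "y \<notin> T" using 2(3) by blast
      obtain U where U: "T \<union> P = U - {x} \<union> P" "U \<in> K" "x \<in> U"
        using down_cases[OF 2(4)] nonface[of "T \<union> P"] by (metis Un_upper2)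
      have "x \<notin> T" by (rule down_x_notin[OF 2(2)])
      then have "insert x T \<subseteq> U \<union> P - {y}" using U y x_notin by blast
      then show ?thesis
        unfolding 2(1) by (rule complex_down[OF absorb[OF U(2,3) y(1)]])
    qed
  qed
  show "K \<subseteq> star_complex L P"
  proof
    fix S assume S: "S \<in> K"
    show "S \<in> star_complex L P"
    proof (cases "x \<in> S")
      case True
      have "S - {x} \<in> L" unfolding blow_down_def using complex_down[OF S, of "S - {x}"] by blast
      moreover have "\<not> P \<subseteq> S - {x}" using nonface[OF S] by blast
      moreover have "S - {x} \<union> P \<in> L" unfolding blow_down_def using S True by blast
      moreover have "S = insert x (S - {x})" using True by blast
      ultimately show ?thesis unfolding star_complex_def sum by blast
    next
      case False
      then have "S \<in> L" unfolding blow_down_def using S by blast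
      then show ?thesis unfolding star_complex_def using nonface[OF S] by blast
    qed
  qed
qed

lemma star_blow_down: "star_subdivision N (Cone ` L) (Cone P) = \<Sigma>"
proof -
  interpret D: smooth_fan N "Cone ` L" by (rule down_smooth)
  have "P \<in> D.K" using P_down down_complex by simp
  then show ?thesis
    using D.star_subdivision_eq[of P] unfolding down_complex star_down fan_eq_image[symmetric] by simp
qed

end

section \<open>Toric varieties determine their fans\<close>

text \<open>
  The points of the toric variety are gluing classes of pairs \<open>(\<sigma>, u)\<close>, and for each \<open>\<sigma>\<close> the
  constant homomorphism 1 is a point of the affine piece, so all cones can be read off.
\<close>
lemma fan_of_T_emb:
  fixes X :: "('a::euclidean_space, 'k::alg_closed_field) toric_point set"
  assumes "X = T_emb N \<Sigma>"
  shows "\<Sigma> = fst ` \<Union> X"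
proof
  show "fst ` \<Union> X \<subseteq> \<Sigma>"
    unfolding assms T_emb_def quotient_def glue_def by auto
  show "\<Sigma> \<subseteq> fst ` \<Union> X"
  proof
    fix \<sigma> assume \<sigma>: "\<sigma> \<in> \<Sigma>"
    define u :: "'a \<Rightarrow> 'k" where "u = restrict (\<lambda>_. 1) (dual_semigroup N \<sigma>)"
    have 0: "0 \<in> dual_semigroup N \<sigma>"
      unfolding dual_semigroup_def dual_lattice_def by (simp add: span_zero)
    have add: "m + m' \<in> dual_semigroup N \<sigma>"
      if "m \<in> dual_semigroup N \<sigma>" "m' \<in> dual_semigroup N \<sigma>" for m m'
      using that unfolding dual_semigroup_def dual_lattice_def
      by (simp add: span_add inner_add_left)
    have u: "u \<in> affine_toric N \<sigma>"
      unfolding affine_toric_def u_def using 0 add by simp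
    have "((\<sigma>, u), (\<sigma>, u)) \<in> glue N \<Sigma>"
      unfolding glue_def using \<sigma> u by (auto simp: u_def intro!: bexI[of _ u])
    then have "(\<sigma>, u) \<in> glue N \<Sigma> `` {(\<sigma>, u)}" by blast
    moreover have "glue N \<Sigma> `` {(\<sigma>, u)} \<in> X"
      unfolding assms T_emb_def by (rule quotientI) (use \<sigma> u in blast)
    ultimately have "(\<sigma>, u) \<in> \<Union> X" by blast
    then show "\<sigma> \<in> fst ` \<Union> X" by force
  qed
qed

lemma T_emb_inject:
  assumes "(T_emb N \<Sigma> :: ('a::euclidean_space, 'k::alg_closed_field) toric_point set) = T_emb N \<Sigma>'"
  shows "\<Sigma> = \<Sigma>'"
proof -
  have "\<Sigma> = fst ` \<Union> (T_emb N \<Sigma> :: ('a, 'k) toric_point set)"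
    by (rule fan_of_T_emb) (rule refl)
  also have "\<dots> = \<Sigma>'"
    by (rule fan_of_T_emb[OF assms, symmetric])
  finally show ?thesis .
qed

section \<open>Characterization of blow-ups by primitive collections\<close>

theorem theorem4p10:
  fixes N :: "'a::euclidean_space set" and d :: nat and \<Sigma> :: "'a set set"
  assumes "free_abelian_of_rank N d"
    and "fan N \<Sigma>" and "finite \<Sigma>" and "complete_fan N \<Sigma>" and "nonsingular_fan N \<Sigma>"
  shows
    "((\<exists>(X :: ('a, 'k::alg_closed_field) toric_point set) \<phi> V c.
          complete_nonsingular_toric_variety N X \<and>
          invariant_subvariety N X V c \<and> 2 \<le> c \<and>
          equivariant_blow_up N (T_emb N \<Sigma>) \<phi> X V)
      \<longleftrightarrow>
      (\<exists>P\<in>PC N \<Sigma>. \<exists>x\<in>fan_gens N \<Sigma>. primitive_relation N \<Sigma> P {x} (\<lambda>_. 1) \<and>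
          (\<forall>\<sigma>\<in>\<Sigma>. x \<in> \<sigma> \<longrightarrow>
             (\<forall>y\<in>P. scrp_cone N (Cone ((cone_gens N \<Sigma> \<sigma> \<union> P) - {y})) \<and>
                    Cone ((cone_gens N \<Sigma> \<sigma> \<union> P) - {y}) \<in> \<Sigma>))))
     \<and>
     ((\<exists>P\<in>PC N \<Sigma>. \<exists>x\<in>fan_gens N \<Sigma>. primitive_relation N \<Sigma> P {x} (\<lambda>_. 1) \<and>
          (\<forall>\<sigma>\<in>\<Sigma>. x \<in> \<sigma> \<longrightarrow>
             (\<forall>y\<in>P. scrp_cone N (Cone ((cone_gens N \<Sigma> \<sigma> \<union> P) - {y})) \<and>
                    Cone ((cone_gens N \<Sigma> \<sigma> \<union> P) - {y}) \<in> \<Sigma>)))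
      \<longleftrightarrow>
      (\<exists>P\<in>PC N \<Sigma>. \<exists>x\<in>fan_gens N \<Sigma>. primitive_relation N \<Sigma> P {x} (\<lambda>_. 1) \<and>
          (\<forall>P'\<in>PC N \<Sigma>. P \<inter> P' \<noteq> {} \<and> P \<noteq> P' \<longrightarrow>
             (\<exists>Q\<in>PC N \<Sigma>. Q \<subseteq> (P' - P) \<union> {x}))))"
    (is "(?blowup \<longleftrightarrow> ?cones) \<and> (_ \<longleftrightarrow> ?collections)")
proof -
  interpret smooth_fan N \<Sigma> by unfold_locales (rule assms)+
  let ?abs = "\<exists>P\<in>PC N \<Sigma>. \<exists>x\<in>fan_gens N \<Sigma>. primitive_relation N \<Sigma> P {x} (\<lambda>_. 1) \<and> absorbs P x"
  have cones: "?cones \<longleftrightarrow> ?abs"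
  proof (intro bex_cong refl conj_cong)
    fix P x assume "P \<in> PC N \<Sigma>" and x: "x \<in> fan_gens N \<Sigma>"
    then have "P \<subseteq> fan_gens N \<Sigma>" unfolding PC_iff by blast
    then show "(\<forall>\<sigma>\<in>\<Sigma>. x \<in> \<sigma> \<longrightarrow>
             (\<forall>y\<in>P. scrp_cone N (Cone ((cone_gens N \<Sigma> \<sigma> \<union> P) - {y})) \<and>
                    Cone ((cone_gens N \<Sigma> \<sigma> \<union> P) - {y}) \<in> \<Sigma>)) \<longleftrightarrow> absorbs P x"
      using x by (rule absorbs_iff_cones)
  qed
  have collections: "?collections \<longleftrightarrow> ?abs"
    by (intro bex_cong refl conj_cong absorbs_iff_PC[symmetric])
  have "?abs" if blowup: ?blowup
  proof -
    obtain X :: "('a, 'k) toric_point set" and \<phi> V where "equivariant_blow_up N (T_emb N \<Sigma>) \<phi> X V"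
      using blowup by blast
    then obtain \<Sigma>' \<sigma> where \<Sigma>': "finite_complete_nonsingular_fan N \<Sigma>'" "\<sigma> \<in> \<Sigma>'" "2 \<le> dim \<sigma>"
      and "(T_emb N \<Sigma> :: ('a, 'k) toric_point set) = T_emb N (star_subdivision N \<Sigma>' \<sigma>)"
      unfolding equivariant_blow_up_def by blast
    then have star: "\<Sigma> = star_subdivision N \<Sigma>' \<sigma>" by (intro T_emb_inject)
    have smooth: "smooth_fan N \<Sigma>'"
      using \<Sigma>'(1) unfolding finite_complete_nonsingular_fan_def smooth_fan_def by blast
    obtain P where P: "P \<in> cone_complex N \<Sigma>'" "\<sigma> = Cone P"
      using smooth_fan.cone_generated[OF smooth \<Sigma>'(2)] .
    have card: "2 \<le> card P"
      using \<Sigma>'(3) dim_Cone[OF smooth_fan.complex_independent[OF smooth P(1)]] P(2) by simp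
    note * = star_subdivision_primitive[OF smooth smooth_fan_axioms P(1) card star[unfolded P(2)]]
    show ?abs by (intro bexI conjI) (rule *)+
  qed
  moreover have ?blowup if ?abs
  proof -
    obtain P x where P: "P \<in> PC N \<Sigma>" and x: "x \<in> fan_gens N \<Sigma>"
      and rel: "primitive_relation N \<Sigma> P {x} (\<lambda>_. 1)" and abs: "absorbs P x"
      using \<open>?abs\<close> by blast
    have "\<Sum>P = x" using rel unfolding primitive_relation_def by simp
    then interpret contractible N \<Sigma> P x
      by unfold_locales (use P x abs in auto)
    let ?\<Sigma>' = "Cone ` L" and ?\<sigma> = "Cone P"
    have smooth: "fan N ?\<Sigma>'" "nonsingular_fan N ?\<Sigma>'"
      using down_smooth unfolding smooth_fan_def by blast+
    have fcn: "finite_complete_nonsingular_fan N ?\<Sigma>'"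
      unfolding finite_complete_nonsingular_fan_def
      using smooth down_finite[OF assms(3)] down_complete[OF assms(4)] by blast
    have \<sigma>: "?\<sigma> \<in> ?\<Sigma>'" using P_down by (rule imageI)
    have dim: "2 \<le> dim ?\<sigma>"
      using dim_Cone[OF basis_part_independent[OF down_basis_part[OF P_down]]] card_P by simp
    let ?X = "T_emb N ?\<Sigma>' :: ('a, 'k) toric_point set"
    show ?blowup
    proof (intro exI conjI)
      show "complete_nonsingular_toric_variety N ?X"
        unfolding complete_nonsingular_toric_variety_def using fcn by blast
      show "invariant_subvariety N ?X (orbit_closure N ?\<Sigma>' ?\<sigma>) (dim ?\<sigma>)"
        unfolding invariant_subvariety_def using smooth(1) \<sigma> by blast
      show "2 \<le> dim ?\<sigma>" by (rule dim)
      show "equivariant_blow_up N (T_emb N \<Sigma>) (toric_morphism N \<Sigma> ?\<Sigma>') ?X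
          (orbit_closure N ?\<Sigma>' ?\<sigma>)"
        unfolding equivariant_blow_up_def
        by (intro exI[of _ ?\<Sigma>'] exI[of _ ?\<sigma>]) (simp add: fcn \<sigma> dim star_blow_down)
    qed
  qed
  ultimately have "?blowup \<longleftrightarrow> ?abs" by (rule iffI)
  then show ?thesis unfolding cones collections by simp
qed

end
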